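(* Let $n\ge3$, $\alpha\in(0,n)$, $p,q>0$ with $pq>1$, and assume $\frac{1}{p+1}+\frac{1}{q+1}\le\frac{n-\alpha}{n}$. If $(u,v)\in L^{r_0}(\mathbb{R}^n)\times L^{s_0}(\mathbb{R}^n)$, where $r_0=\frac{n(pq-1)}{\alpha(q+1)}$, $s_0=\frac{n(pq-1)}{\alpha(p+1)}$, is a pair of positive solutions of $$u(x)=\int_{\mathbb{R}^n}\frac{v^q(y)\,dy}{|x-y|^{n-\alpha}},\qquad v(x)=\int_{\mathbb{R}^n}\frac{u^p(y)\,dy}{|x-y|^{n-\alpha}},$$ then $u,v$ are bounded on $\mathbb{R}^n$ and $\lim_{|x|\to\infty}u(x)=\lim_{|x|\to\infty}v(x)=0$.
   Context: Positive solutions are positive measurable functions satisfying both integral identities (finite) at every point. *)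

theory Defs
  imports "HOL-Analysis.Analysis"
begin

definition riesz_identity ::
  "real \<Rightarrow> (real^'n \<Rightarrow> real) \<Rightarrow> real \<Rightarrow> (real^'n \<Rightarrow> real) \<Rightarrow> bool" where
  "riesz_identity \<alpha> w e f \<longleftrightarrow>
     (\<forall>x. integrable lebesgue (\<lambda>y. f y powr e / norm (x - y) powr (real CARD('n) - \<alpha>)) \<and>
          w x = (\<integral>y. f y powr e / norm (x - y) powr (real CARD('n) - \<alpha>) \<partial>lebesgue))"

definition positive_solution ::
  "real \<Rightarrow> real \<Rightarrow> real \<Rightarrow> (real^'n \<Rightarrow> real) \<Rightarrow> (real^'n \<Rightarrow> real) \<Rightarrow> bool" where
  "positive_solution \<alpha> p q u v \<longleftrightarrow>
     u \<in> borel_measurable lebesgue \<and> v \<in> borel_measurable lebesgue \<and>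
     (\<forall>x. u x > 0) \<and> (\<forall>x. v x > 0) \<and>
     riesz_identity \<alpha> u q v \<and> riesz_identity \<alpha> v p u"

definition in_Lp :: "real \<Rightarrow> (real^'n \<Rightarrow> real) \<Rightarrow> bool" where
  "in_Lp r f \<longleftrightarrow> f \<in> borel_measurable lebesgue \<and> integrable lebesgue (\<lambda>x. \<bar>f x\<bar> powr r)"

end

(* Put a = n / r0 and b = n / s0, so that q b = a + alpha, p a = b + alpha and a + b <= n - alpha.
   For f = v^q, which lies in L^sigma with sigma = n / (a + alpha), split
   f = f 1[f <= m] + f 1[m < f <= l^(a + alpha)] + f 1[f > l^(a + alpha)].
   For m large and then l large, the first two parts have Riesz potential at most l^a / 4 each, so on
   the set u > l^a the third part has potential at least l^a / 2, and the weak-type estimate for L^1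
   bounds the measure of that set. With X l = l^n |{u > l^a}| and Y l = l^n |{v > l^b}| this reads
   X l <= (C sup_(s >= l) Y s)^(n / (n - alpha)), and symmetrically with X and Y exchanged. The
   exponent exceeds 1 and both quantities tend to 0, so they vanish for l large: u and v are
   essentially bounded. Boundedness and decay at every point then follow from the integral
   identities. *)

theory Submission
  imports Defs
begin

section \<open>Integrals of powers of the norm\<close>

text \<open>The exponents \<open>a\<close> and \<open>b\<close> are the scaling exponents of the
  system: passing from u, v to c^a u(c x), c^b v(c x) preserves both identities and leaves the norms
  in L^r0 and L^s0 unchanged. The assumed integrability is therefore exactly critical: the
  Hardy-Littlewood-Sobolev inequality merely returns it, and iterating that inequality improves no
  exponent. The gain comes instead from high levels, where critical tails are small by dominated
  convergence. There the high part is estimated in L^1 by its weak L^sigma tail, which is possible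
  because sigma > 1; the result is linear in the tail until the weak-type inequality raises it to a
  power. The condition sigma > 1 says a + alpha < n and follows from a + b <= n - alpha and b > 0;
  this is where the inequality between p, q and alpha is spent. The companion condition alpha sigma
  < n says a > 0. As the supremum runs over s >= l, the iteration never leaves a fixed half-line.
  Potentials ignore null sets, so essential bounds on v yield bounds on u at every point.\<close>

lemma sigma_finite_lebesgue: "sigma_finite_measure (lebesgue :: 'a::euclidean_space measure)"
proof
  show "\<exists>A. countable A \<and> A \<subseteq> sets (lebesgue :: 'a measure) \<and> \<Union> A = space lebesgue \<and>
        (\<forall>a\<in>A. emeasure lebesgue a \<noteq> \<infinity>)"
  proof (intro exI[of _ "range (\<lambda>n::nat. cball (0::'a) (real n))"] conjI ballI)
    show "\<Union> (range (\<lambda>n::nat. cball (0::'a) (real n))) = space lebesgue"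
      by (auto simp: real_arch_simple)
    show "emeasure lebesgue a \<noteq> \<infinity>" if "a \<in> range (\<lambda>n::nat. cball (0::'a) (real n))" for a
      using that by (auto simp: emeasure_cball)
  qed auto
qed

text \<open>Lets the coordinate projections of \<open>lebesgue \<Otimes>\<^sub>M lebesgue\<close>
  count as Borel functions, so that the kernel is jointly measurable there and Tonelli
  applies.\<close>

lemma ident_measurable_lebesgue: "(\<lambda>y. y) \<in> borel_measurable lebesgue"
  by (rule measurable_completion) simp

text \<open>On the shell of index \<open>j\<close> the kernel is at most
  \<open>(r * t ^ j) powr e\<close>, and the shell lies in a ball of volume comparable to
  \<open>(r * t ^ j) ^ DIM('a)\<close>. The shells thus contribute a geometric series with ratio
  \<open>t powr (real DIM('a) + e)\<close>. The same bound serves shrinking shells,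
  \<open>t = 1/2\<close>, and growing ones, \<open>t = 2\<close>.\<close>

lemma nn_integral_norm_powr_dyadic:
  fixes e t :: real
  assumes "e \<le> 0" "0 < t" "t powr (real DIM('a::euclidean_space) + e) < 1"
  shows "\<exists>C>0. \<forall>(x::'a) (S::'a set) r.
    0 < r \<longrightarrow> S \<in> sets lebesgue \<longrightarrow>
    (\<forall>y\<in>S. y \<noteq> x \<longrightarrow> (\<exists>j::nat. r * t ^ j \<le> norm (x - y) \<and> norm (x - y) \<le> 2 * (r * t ^ j))) \<longrightarrow>
    (\<integral>\<^sup>+y. indicator S y * ennreal (norm (x - y) powr e) \<partial>lebesgue)
      \<le> ennreal (C * r powr (real DIM('a) + e))"
proof -
  define n where "n = real DIM('a)"
  define W where "W = unit_ball_vol n * 2 ^ DIM('a)"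
  have W: "W > 0" by (simp add: W_def n_def unit_ball_vol_pos)
  define T where "T = t powr (n + e)"
  have T: "0 < T" "T < 1" using assms by (auto simp: T_def n_def)
  have "(\<integral>\<^sup>+y. indicator S y * ennreal (norm (x - y) powr e) \<partial>lebesgue)
      \<le> ennreal (W / (1 - T) * r powr (n + e))"
    if r: "0 < r" and S: "S \<in> sets lebesgue" and
       cov: "\<forall>y\<in>S. y \<noteq> x \<longrightarrow> (\<exists>j::nat. r * t ^ j \<le> norm (x - y) \<and> norm (x - y) \<le> 2 * (r * t ^ j))"
    for x :: 'a and S r
  proof -
    define \<rho> where "\<rho> j = r * t ^ j" for j
    have \<rho>: "\<rho> j > 0" for j using r assms by (simp add: \<rho>_def)
    define F where "F j y = ennreal (\<rho> j powr e) * indicator (cball x (2 * \<rho> j)) y" for j y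
    have [measurable]: "F j \<in> borel_measurable lebesgue" for j
      unfolding F_def by (intro borel_measurable_times_ennreal borel_measurable_const borel_measurable_indicator) simp
    have pt: "indicator S y * ennreal (norm (x - y) powr e) \<le> (\<Sum>j. F j y)" for y
    proof (cases "y \<in> S \<and> y \<noteq> x")
      case True
      then obtain j where j: "\<rho> j \<le> norm (x - y)" "norm (x - y) \<le> 2 * \<rho> j"
        using cov by (auto simp: \<rho>_def)
      have "norm (x - y) powr e \<le> \<rho> j powr e"
        using j(1) \<rho>[of j] assms(1) by (intro powr_mono2') auto
      then have "indicator S y * ennreal (norm (x - y) powr e) \<le> F j y"
        using True j by (auto simp: F_def dist_norm ennreal_leI)
      also have "\<dots> \<le> (\<Sum>j. F j y)"
        using sum_le_suminf[of "\<lambda>j. F j y" "{j}"] by simp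
      finally show ?thesis .
    next
      \<comment> \<open>At \<open>y = x\<close> the integrand vanishes because
        \<open>0 powr e = 0\<close>, so the shells need not cover the centre.\<close>
      case False
      then show ?thesis by (auto simp: indicator_def)
    qed
    have intF: "(\<integral>\<^sup>+y. F j y \<partial>lebesgue) = ennreal (W * r powr (n + e) * T ^ j)" for j
    proof -
      have "(\<integral>\<^sup>+y. F j y \<partial>lebesgue) = ennreal (\<rho> j powr e) * emeasure lebesgue (cball x (2 * \<rho> j))"
        unfolding F_def by (subst nn_integral_cmult_indicator) auto
      also have "\<dots> = ennreal (\<rho> j powr e * (unit_ball_vol n * (2 * \<rho> j) ^ DIM('a)))"
        using \<rho>[of j] by (simp add: emeasure_cball n_def ennreal_mult'')
      also have "\<rho> j powr e * (unit_ball_vol n * (2 * \<rho> j) ^ DIM('a)) = W * \<rho> j powr (n + e)"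
        using \<rho>[of j] by (simp add: W_def n_def powr_add powr_realpow power_mult_distrib)
      also have "\<rho> j powr (n + e) = r powr (n + e) * T ^ j"
      proof -
        have "(t ^ j) powr (n + e) = (t powr real j) powr (n + e)"
          using assms(2) by (simp add: powr_realpow)
        also have "\<dots> = T powr real j" by (simp add: T_def powr_powr mult.commute)
        also have "\<dots> = T ^ j" using T by (simp add: powr_realpow)
        finally show ?thesis using r assms(2) by (simp add: \<rho>_def powr_mult)
      qed
      finally show ?thesis by (simp add: mult.assoc)
    qed
    have "(\<integral>\<^sup>+y. indicator S y * ennreal (norm (x - y) powr e) \<partial>lebesgue) \<le> (\<integral>\<^sup>+y. (\<Sum>j. F j y) \<partial>lebesgue)"
      by (intro nn_integral_mono pt)
    also have "\<dots> = (\<Sum>j. \<integral>\<^sup>+y. F j y \<partial>lebesgue)"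
      by (intro nn_integral_suminf) auto
    also have "\<dots> = (\<Sum>j. ennreal (W * r powr (n + e) * T ^ j))" by (simp add: intF)
    also have "\<dots> = ennreal (W * r powr (n + e) * (1 / (1 - T)))"
      using T W by (intro suminf_ennreal_eq sums_mult geometric_sums) auto
    finally show ?thesis by (simp add: mult_ac)
  qed
  then show ?thesis using W T
    by (intro exI[of _ "W / (1 - T)"]) (auto simp: n_def)
qed

lemma nn_integral_norm_powr_ball:
  assumes "0 < \<alpha>" "\<alpha> < real DIM('a::euclidean_space)"
  shows "\<exists>C>0. \<forall>(x::'a) r. 0 < r \<longrightarrow>
    (\<integral>\<^sup>+y. indicator (ball x r) y * ennreal (norm (x - y) powr (\<alpha> - real DIM('a))) \<partial>lebesgue)
      \<le> ennreal (C * r powr \<alpha>)"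
proof -
  define n where "n = real DIM('a)"
  have "(1/2::real) powr (real DIM('a) + (\<alpha> - n)) < 1"
    using assms powr_less_mono2[of \<alpha> "1/2" 1] by (simp add: n_def)
  from nn_integral_norm_powr_dyadic[OF _ _ this] assms
  obtain C where C: "C > 0" and bd: "\<And>(x::'a) S r. 0 < r \<Longrightarrow> S \<in> sets lebesgue \<Longrightarrow>
    (\<forall>y\<in>S. y \<noteq> x \<longrightarrow> (\<exists>j::nat. r * (1/2) ^ j \<le> norm (x - y) \<and> norm (x - y) \<le> 2 * (r * (1/2) ^ j))) \<Longrightarrow>
    (\<integral>\<^sup>+y. indicator S y * ennreal (norm (x - y) powr (\<alpha> - n)) \<partial>lebesgue)
      \<le> ennreal (C * r powr (n + (\<alpha> - n)))"
    by (auto simp: n_def)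
  have "(\<integral>\<^sup>+y. indicator (ball x r) y * ennreal (norm (x - y) powr (\<alpha> - n)) \<partial>lebesgue)
      \<le> ennreal (C * r powr \<alpha>)" if r: "0 < r" for x :: 'a and r
  proof -
    \<comment> \<open>Starting at \<open>r / 2\<close> puts the outer radius of shell 0 at
      \<open>r\<close>, so the shells exhaust the punctured ball.\<close>
    have cov: "\<exists>j::nat. r / 2 * (1/2) ^ j \<le> norm (x - y) \<and> norm (x - y) \<le> 2 * (r / 2 * (1/2) ^ j)"
      if "y \<in> ball x r" "y \<noteq> x" for y
    proof -
      define s where "s = norm (x - y)"
      have s: "0 < s" "s < r" using that by (auto simp: s_def dist_norm)
      have ex: "\<exists>j::nat. r / 2 * (1/2) ^ j \<le> s"
      proof -
        obtain j where "(1/2) ^ j < s / r"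
          using real_arch_pow_inv[of "s / r" "1/2"] s r by auto
        then have "r * (1/2) ^ j < s" using r by (simp add: pos_less_divide_eq mult.commute)
        moreover have "0 \<le> r * (1/2) ^ j" using r by simp
        ultimately show ?thesis by (intro exI[of _ j]) simp
      qed
      \<comment> \<open>Minimality yields the outer bound: the preceding, larger inner radius
        already exceeds \<open>s\<close>.\<close>
      define j where "j = (LEAST j. r / 2 * (1/2::real) ^ j \<le> s)"
      have j: "r / 2 * (1/2) ^ j \<le> s" unfolding j_def by (rule LeastI_ex[OF ex])
      have "s \<le> r * (1/2) ^ j"
      proof (cases j)
        case 0
        then show ?thesis using s by simp
      next
        case (Suc i)
        then have "\<not> r / 2 * (1/2) ^ i \<le> s"
          using not_less_Least[of i "\<lambda>j. r / 2 * (1/2::real) ^ j \<le> s"] by (auto simp: j_def)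
        then show ?thesis using Suc by simp
      qed
      with j show ?thesis by (auto simp: s_def)
    qed
    have "(\<integral>\<^sup>+y. indicator (ball x r) y * ennreal (norm (x - y) powr (\<alpha> - n)) \<partial>lebesgue)
        \<le> ennreal (C * (r / 2) powr (n + (\<alpha> - n)))"
      using cov r by (intro bd) auto
    also have "\<dots> \<le> ennreal (C * r powr \<alpha>)"
      using r assms C by (intro ennreal_leI mult_left_mono) (auto intro!: powr_mono2)
    finally show ?thesis .
  qed
  with C show ?thesis by (auto simp: n_def)
qed

lemma nn_integral_norm_powr_outside_ball:
  assumes "real DIM('a::euclidean_space) + e < 0"
  shows "\<exists>C>0. \<forall>(x::'a) r. 0 < r \<longrightarrow>
    (\<integral>\<^sup>+y. indicator (- ball x r) y * ennreal (norm (x - y) powr e) \<partial>lebesgue)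
      \<le> ennreal (C * r powr (real DIM('a) + e))"
proof -
  have "(2::real) powr (real DIM('a) + e) < 1"
    using assms powr_less_mono[of "real DIM('a) + e" 0 2] by simp
  from nn_integral_norm_powr_dyadic[OF _ _ this] assms
  obtain C where C: "C > 0" and bd: "\<And>(x::'a) S r. 0 < r \<Longrightarrow> S \<in> sets lebesgue \<Longrightarrow>
    (\<forall>y\<in>S. y \<noteq> x \<longrightarrow> (\<exists>j::nat. r * 2 ^ j \<le> norm (x - y) \<and> norm (x - y) \<le> 2 * (r * 2 ^ j))) \<Longrightarrow>
    (\<integral>\<^sup>+y. indicator S y * ennreal (norm (x - y) powr e) \<partial>lebesgue)
      \<le> ennreal (C * r powr (real DIM('a) + e))"
    by auto
  have "(\<integral>\<^sup>+y. indicator (- ball x r) y * ennreal (norm (x - y) powr e) \<partial>lebesgue)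
      \<le> ennreal (C * r powr (real DIM('a) + e))" if r: "0 < r" for x :: 'a and r
  proof (rule bd[OF r])
    show "\<forall>y\<in>- ball x r. y \<noteq> x \<longrightarrow> (\<exists>j::nat. r * 2 ^ j \<le> norm (x - y) \<and> norm (x - y) \<le> 2 * (r * 2 ^ j))"
    proof (intro ballI impI)
      fix y assume "y \<in> - ball x r"
      define s where "s = norm (x - y)"
      have s: "r \<le> s" using \<open>y \<in> - ball x r\<close> by (auto simp: s_def dist_norm)
      have ex: "\<exists>j::nat. s \<le> 2 * (r * 2 ^ j)"
      proof -
        obtain j where "s / r < 2 ^ j"
          using real_arch_pow[of 2 "s / r"] by auto
        then have "s < r * 2 ^ j" using r by (simp add: pos_divide_less_eq mult.commute)
        moreover have "0 \<le> r * 2 ^ j" using r by simp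
        ultimately show ?thesis by (intro exI[of _ j]) simp
      qed
      define j where "j = (LEAST j. s \<le> 2 * (r * 2 ^ j))"
      have j: "s \<le> 2 * (r * 2 ^ j)" unfolding j_def by (rule LeastI_ex[OF ex])
      have "r * 2 ^ j \<le> s"
      proof (cases j)
        case 0
        then show ?thesis using s by simp
      next
        case (Suc i)
        then have "\<not> s \<le> 2 * (r * 2 ^ i)"
          using not_less_Least[of i "\<lambda>j. s \<le> 2 * (r * 2 ^ j)"] by (auto simp: j_def)
        then show ?thesis using Suc by simp
      qed
      with j show "\<exists>j::nat. r * 2 ^ j \<le> norm (x - y) \<and> norm (x - y) \<le> 2 * (r * 2 ^ j)"
        by (auto simp: s_def)
    qed
  qed auto
  with C show ?thesis by auto
qed

section \<open>Riesz potentials\<close>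

text \<open>Since \<open>0 powr e = 0\<close>, the kernel vanishes on the diagonal.\<close>
definition riesz :: "real \<Rightarrow> ('a::euclidean_space \<Rightarrow> real) \<Rightarrow> 'a \<Rightarrow> ennreal" where
  "riesz \<alpha> f x = (\<integral>\<^sup>+y. ennreal (f y * norm (x - y) powr (\<alpha> - real DIM('a))) \<partial>lebesgue)"

lemma measurable_norm_powr_lebesgue:
  "(\<lambda>y::'a::euclidean_space. norm (x - y) powr e) \<in> borel_measurable lebesgue"
  by (rule measurable_completion) measurable

lemma measurable_riesz_integrand:
  assumes "f \<in> borel_measurable lebesgue"
  shows "(\<lambda>y::'a::euclidean_space. ennreal (f y * norm (x - y) powr e)) \<in> borel_measurable lebesgue"
  by (intro measurable_compose[OF _ measurable_ennreal] borel_measurable_times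
      measurable_norm_powr_lebesgue assms)

lemma riesz_mono_AE:
  assumes "AE y in lebesgue. f y \<le> g y"
  shows "riesz \<alpha> f x \<le> riesz \<alpha> g x"
  unfolding riesz_def
  by (rule nn_integral_mono_AE, use assms in eventually_elim) (auto intro!: ennreal_leI mult_right_mono)

lemma riesz_add:
  assumes "f \<in> borel_measurable lebesgue" "g \<in> borel_measurable lebesgue"
    "\<And>y. 0 \<le> f y" "\<And>y. 0 \<le> g y"
  shows "riesz \<alpha> (\<lambda>y. f y + g y) x = riesz \<alpha> f x + riesz \<alpha> g x"
  unfolding riesz_def distrib_right
  using assms by (subst nn_integral_add[symmetric])
    (auto intro!: measurable_compose[OF _ measurable_ennreal] borel_measurable_times
      measurable_norm_powr_lebesgue nn_integral_cong ennreal_plus)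

text \<open>Near field by \<open>f \<le> m\<close>, far field by Young's inequality with the weight
  \<open>norm (x - y) powr (- s)\<close>, where \<open>s\<close> is the one exponent for which the kernel cancels
  in the \<open>\<sigma>\<close>-th power term.\<close>
lemma riesz_le_split:
  fixes \<alpha> \<sigma> :: real
  assumes \<alpha>: "0 < \<alpha>" and \<sigma>: "1 < \<sigma>" and \<alpha>\<sigma>: "\<alpha> * \<sigma> < real DIM('a::euclidean_space)"
  shows "\<exists>C>0. \<forall>(f::'a \<Rightarrow> real) m E x \<delta> \<theta>.
    f \<in> borel_measurable lebesgue \<longrightarrow> (\<forall>y. 0 \<le> f y) \<longrightarrow> (AE y in lebesgue. f y \<le> m) \<longrightarrow> 0 \<le> m \<longrightarrow>
    0 \<le> E \<longrightarrow> (\<integral>\<^sup>+y. ennreal (f y powr \<sigma>) \<partial>lebesgue) \<le> ennreal E \<longrightarrow> 0 < \<delta> \<longrightarrow> 0 < \<theta> \<longrightarrow>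
    riesz \<alpha> f x \<le> ennreal (C * m * \<delta> powr \<alpha>
      + (C * \<theta> + \<theta> powr (1 - \<sigma>) * E) * \<delta> powr (- (real DIM('a) / \<sigma> - \<alpha>)))"
proof -
  define n where "n = real DIM('a)"
  define a where "a = n / \<sigma> - \<alpha>"
  define s where "s = (n - \<alpha>) / (\<sigma> - 1)"
  define t where "t = a / (\<sigma> - 1)"
  have n: "n = (a + \<alpha>) * \<sigma>" using \<sigma> by (simp add: a_def)
  have \<alpha>n: "\<alpha> < n" using \<alpha> \<sigma> \<alpha>\<sigma> mult_strict_left_mono[of 1 \<sigma> \<alpha>]
    unfolding n_def by linarith
  have s: "s > 0" "s * (\<sigma> - 1) = n - \<alpha>" using \<sigma> \<alpha>n by (auto simp: s_def)
  have t: "t * (1 - \<sigma>) = - a" using \<sigma> by (simp add: t_def field_simps)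
  \<comment> \<open>This sign makes the weighted kernel integrable at infinity, and it is where
    \<open>\<alpha> * \<sigma> < real DIM('a)\<close> enters.\<close>
  have "(\<alpha> - s) * (\<sigma> - 1) = \<alpha> * \<sigma> - n" using s(2) by (simp add: algebra_simps)
  also have "\<dots> < 0" using \<alpha>\<sigma> by (simp add: n_def)
  finally have \<alpha>s: "\<alpha> - s < 0" using \<sigma> by (simp add: mult_less_0_iff)
  have ts: "t + (\<alpha> - s) = - a"
  proof -
    have "(t + (\<alpha> - s)) * (\<sigma> - 1) = a + (\<alpha> * \<sigma> - n)"
      using s(2) t by (simp add: algebra_simps)
    also have "\<dots> = (- a) * (\<sigma> - 1)" by (simp add: n algebra_simps)
    finally show ?thesis using \<sigma> by (metis mult_cancel_right diff_gt_0_iff_gt less_irrefl)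
  qed
  obtain C1 where C1: "C1 > 0" and near: "\<And>(x::'a) r. 0 < r \<Longrightarrow>
    (\<integral>\<^sup>+y. indicator (ball x r) y * ennreal (norm (x - y) powr (\<alpha> - n)) \<partial>lebesgue)
      \<le> ennreal (C1 * r powr \<alpha>)"
    using nn_integral_norm_powr_ball[where 'a='a, of \<alpha>] \<alpha> \<alpha>n by (auto simp: n_def)
  define e where "e = \<alpha> - n - s"
  have ne: "n + e = \<alpha> - s" by (simp add: e_def)
  obtain C2 where C2: "C2 > 0" and far: "\<And>(x::'a) r. 0 < r \<Longrightarrow>
    (\<integral>\<^sup>+y. indicator (- ball x r) y * ennreal (norm (x - y) powr e) \<partial>lebesgue)
      \<le> ennreal (C2 * r powr (\<alpha> - s))"
    using nn_integral_norm_powr_outside_ball[where 'a='a, of e] \<alpha>s ne by (auto simp: n_def)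
  define C where "C = max C1 C2"
  have "riesz \<alpha> f x \<le> ennreal (C * m * \<delta> powr \<alpha> + (C * \<theta> + \<theta> powr (1 - \<sigma>) * E) * \<delta> powr (- a))"
    if f: "f \<in> borel_measurable lebesgue" "\<forall>y. 0 \<le> f y" and fm: "AE y in lebesgue. f y \<le> m" and m: "0 \<le> m"
      and E: "0 \<le> E" "(\<integral>\<^sup>+y. ennreal (f y powr \<sigma>) \<partial>lebesgue) \<le> ennreal E"
      and \<delta>: "0 < \<delta>" and \<theta>: "0 < \<theta>" for f :: "'a \<Rightarrow> real" and m E x \<delta> \<theta>
  proof -
    \<comment> \<open>The power of \<open>\<delta>\<close> in \<open>\<eta>\<close> is chosen so
      that the weight term \<open>\<eta> * \<delta> powr (\<alpha> - s)\<close> and the coefficient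
      \<open>\<eta> powr (1 - \<sigma>)\<close> both scale like \<open>\<delta> powr (- a)\<close>.
      The factor \<open>\<theta>\<close> stays free, to be balanced against \<open>E\<close>
      later.\<close>
    define \<eta> where "\<eta> = \<theta> * \<delta> powr t"
    have \<eta>: "\<eta> > 0" using \<theta> \<delta> by (simp add: \<eta>_def)
    have \<eta>1: "\<eta> powr (1 - \<sigma>) = \<theta> powr (1 - \<sigma>) * \<delta> powr (- a)"
      using \<theta> \<delta> t by (simp add: \<eta>_def powr_mult powr_powr)
    have \<eta>2: "\<eta> * \<delta> powr (\<alpha> - s) = \<theta> * \<delta> powr (- a)"
      using ts by (simp add: \<eta>_def powr_add[symmetric])
    define k where "k y = norm (x - y) powr (\<alpha> - n)" for y
    define F1 where "F1 y = indicator (ball x \<delta>) y * ennreal (k y)" for y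
    define F2 where "F2 y = indicator (- ball x \<delta>) y * ennreal (norm (x - y) powr e)" for y
    define F3 where "F3 y = ennreal (f y powr \<sigma>)" for y
    have meas: "F1 \<in> borel_measurable lebesgue" "F2 \<in> borel_measurable lebesgue" "F3 \<in> borel_measurable lebesgue"
      unfolding F1_def F2_def F3_def k_def
      by (auto intro!: borel_measurable_times_ennreal measurable_compose[OF _ measurable_ennreal]
          measurable_norm_powr_lebesgue borel_measurable_indicator powr_real_measurable f)
    have pt: "ennreal (f y * k y) \<le> ennreal m * F1 y + (ennreal \<eta> * F2 y + ennreal (\<eta> powr (1 - \<sigma>)) * F3 y)"
      if fy: "f y \<le> m" for y
    proof (cases "y \<in> ball x \<delta>")
      case True
      have "ennreal (f y * k y) \<le> ennreal (m * k y)"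
        using fy by (intro ennreal_leI mult_right_mono) (auto simp: k_def)
      also have "\<dots> = ennreal m * F1 y" using True m by (simp add: F1_def ennreal_mult' k_def)
      finally show ?thesis by (rule add_increasing2[rotated]) simp
    next
      case False
      define z where "z = norm (x - y)"
      have z: "z > 0" using False \<delta> by (auto simp: z_def dist_norm)
      \<comment> \<open>The threshold in Young's inequality: values of \<open>f\<close> up to
        \<open>h\<close> are replaced by \<open>h\<close>; larger values are traded for
        \<open>f y powr \<sigma>\<close> at the cost \<open>h powr (1 - \<sigma>)\<close>, whose
        power of \<open>z\<close> cancels the kernel.\<close>
      define h where "h = \<eta> * z powr (- s)"
      have h: "h > 0" using \<eta> z by (simp add: h_def)
      have "f y * k y \<le> \<eta> * z powr e + \<eta> powr (1 - \<sigma>) * f y powr \<sigma>"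
      proof (cases "f y \<le> h")
        case True
        then have "f y * k y \<le> h * k y" by (intro mult_right_mono) (auto simp: k_def)
        also have "\<dots> = \<eta> * z powr e"
          by (simp add: h_def k_def z_def e_def powr_add[symmetric] mult.assoc)
        finally show ?thesis by (simp add: add_increasing2)
      next
        case False
        then have fy: "f y > h" "f y > 0" using h by auto
        have "f y = f y powr \<sigma> * f y powr (1 - \<sigma>)" using fy by (simp add: powr_add[symmetric])
        also have "\<dots> \<le> f y powr \<sigma> * h powr (1 - \<sigma>)"
          using fy h \<sigma> by (intro mult_left_mono powr_mono2') auto
        finally have "f y * k y \<le> (f y powr \<sigma> * h powr (1 - \<sigma>)) * k y"
          by (intro mult_right_mono) (auto simp: k_def)
        also have "h powr (1 - \<sigma>) = \<eta> powr (1 - \<sigma>) * z powr (n - \<alpha>)"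
        proof -
          have "- s * (1 - \<sigma>) = n - \<alpha>" using s(2) by (simp add: algebra_simps)
          then show ?thesis using \<eta> z by (simp add: h_def powr_mult powr_powr)
        qed
        also have "f y powr \<sigma> * (\<eta> powr (1 - \<sigma>) * z powr (n - \<alpha>)) * k y
            = \<eta> powr (1 - \<sigma>) * f y powr \<sigma> * (z powr (n - \<alpha>) * z powr (\<alpha> - n))"
          by (simp add: k_def z_def)
        also have "\<dots> = \<eta> powr (1 - \<sigma>) * f y powr \<sigma>"
          using z by (simp add: powr_add[symmetric])
        finally show ?thesis using \<eta> by (simp add: add_increasing)
      qed
      then have "ennreal (f y * k y) \<le> ennreal (\<eta> * z powr e + \<eta> powr (1 - \<sigma>) * f y powr \<sigma>)"
        by (rule ennreal_leI)
      also have "\<dots> = ennreal \<eta> * F2 y + ennreal (\<eta> powr (1 - \<sigma>)) * F3 y"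
        using False \<eta> by (simp add: F2_def F3_def z_def ennreal_mult)
      finally show ?thesis by (rule add_increasing[rotated]) simp
    qed
    have "riesz \<alpha> f x = (\<integral>\<^sup>+y. ennreal (f y * k y) \<partial>lebesgue)" by (simp add: riesz_def k_def n_def)
    also have "\<dots> \<le> (\<integral>\<^sup>+y. ennreal m * F1 y + (ennreal \<eta> * F2 y + ennreal (\<eta> powr (1 - \<sigma>)) * F3 y) \<partial>lebesgue)"
      by (rule nn_integral_mono_AE, use fm in eventually_elim) (rule pt)
    also have "\<dots> = ennreal m * (\<integral>\<^sup>+y. F1 y \<partial>lebesgue) + (ennreal \<eta> * (\<integral>\<^sup>+y. F2 y \<partial>lebesgue)
        + ennreal (\<eta> powr (1 - \<sigma>)) * (\<integral>\<^sup>+y. F3 y \<partial>lebesgue))"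
      using meas by (simp add: nn_integral_add nn_integral_cmult)
    also have "\<dots> \<le> ennreal m * ennreal (C1 * \<delta> powr \<alpha>) + (ennreal \<eta> * ennreal (C2 * \<delta> powr (\<alpha> - s))
        + ennreal (\<eta> powr (1 - \<sigma>)) * ennreal E)"
      unfolding F1_def F2_def F3_def k_def
      by (intro add_mono mult_left_mono near far E \<delta>) auto
    also have "\<dots> = ennreal (m * (C1 * \<delta> powr \<alpha>) + (\<eta> * (C2 * \<delta> powr (\<alpha> - s)) + \<eta> powr (1 - \<sigma>) * E))"
      using m C1 C2 \<eta> E by (simp add: ennreal_mult)
    also have "\<dots> \<le> ennreal (C * m * \<delta> powr \<alpha> + (C * \<theta> + \<theta> powr (1 - \<sigma>) * E) * \<delta> powr (- a))"
    proof (rule ennreal_leI)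
      have 1: "m * (C1 * \<delta> powr \<alpha>) \<le> C * m * \<delta> powr \<alpha>"
      proof -
        have "C1 * (m * \<delta> powr \<alpha>) \<le> C * (m * \<delta> powr \<alpha>)"
          using m by (intro mult_right_mono) (auto simp: C_def)
        then show ?thesis by (simp add: mult_ac)
      qed
      have 2: "\<eta> * (C2 * \<delta> powr (\<alpha> - s)) \<le> C * \<theta> * \<delta> powr (- a)"
      proof -
        have "\<eta> * (C2 * \<delta> powr (\<alpha> - s)) = C2 * (\<eta> * \<delta> powr (\<alpha> - s))" by simp
        also have "\<dots> = C2 * (\<theta> * \<delta> powr (- a))" unfolding \<eta>2 ..
        also have "\<dots> \<le> C * (\<theta> * \<delta> powr (- a))"
          using \<theta> by (intro mult_right_mono) (auto simp: C_def)
        finally show ?thesis by (simp add: mult_ac)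
      qed
      show "m * (C1 * \<delta> powr \<alpha>) + (\<eta> * (C2 * \<delta> powr (\<alpha> - s)) + \<eta> powr (1 - \<sigma>) * E)
        \<le> C * m * \<delta> powr \<alpha> + (C * \<theta> + \<theta> powr (1 - \<sigma>) * E) * \<delta> powr (- a)"
        using 1 2 unfolding \<eta>1 by (simp add: algebra_simps)
    qed
    finally show ?thesis .
  qed
  moreover have "C > 0" using C1 by (simp add: C_def)
  ultimately show ?thesis unfolding a_def n_def by blast
qed

text \<open>Split the kernel at the radius \<open>\<delta>\<close> for which \<open>\<delta>\<^sup>n\<close> is the measure of \<open>A\<close>.\<close>
lemma riesz_indicator_le:
  assumes \<alpha>: "0 < \<alpha>" "\<alpha> < real DIM('a::euclidean_space)"
  shows "\<exists>C>0. \<forall>(A::'a set) x. A \<in> lmeasurable \<longrightarrow>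
    riesz \<alpha> (indicat_real A) x \<le> ennreal (C * measure lebesgue A powr (\<alpha> / real DIM('a)))"
proof -
  define n where "n = real DIM('a)"
  have n: "n > 0" by (simp add: n_def)
  obtain C1 where C1: "C1 > 0" and near: "\<And>(x::'a) r. 0 < r \<Longrightarrow>
    (\<integral>\<^sup>+y. indicator (ball x r) y * ennreal (norm (x - y) powr (\<alpha> - n)) \<partial>lebesgue)
      \<le> ennreal (C1 * r powr \<alpha>)"
    using nn_integral_norm_powr_ball[where 'a='a, of \<alpha>] \<alpha> by (auto simp: n_def)
  have "riesz \<alpha> (indicat_real A) x \<le> ennreal ((C1 + 1) * measure lebesgue A powr (\<alpha> / n))"
    if A: "A \<in> lmeasurable" for A :: "'a set" and x
  proof (cases "measure lebesgue A = 0")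
    \<comment> \<open>A null set would give the splitting radius 0, so it is treated apart; its
      potential is zero.\<close>
    case True
    then have "A \<in> null_sets lebesgue"
      using A by (simp add: null_sets_def fmeasurableD emeasure_eq_measure2)
    then have "AE y in lebesgue. y \<notin> A" by (rule AE_not_in)
    then have "AE y in lebesgue. ennreal (indicat_real A y * norm (x - y) powr (\<alpha> - n)) = 0"
      by eventually_elim simp
    then have "riesz \<alpha> (indicat_real A) x = (\<integral>\<^sup>+(y::'a). 0 \<partial>lebesgue)"
      unfolding riesz_def n_def by (rule nn_integral_cong_AE)
    then show ?thesis by simp
  next
    case False
    define \<mu> where "\<mu> = measure lebesgue A"
    have \<mu>: "\<mu> > 0" using False by (simp add: \<mu>_def zero_less_measure_iff)
    define \<delta> where "\<delta> = \<mu> powr (1 / n)"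
    have \<delta>: "\<delta> > 0" using \<mu> by (simp add: \<delta>_def)
    have Am: "A \<in> sets lebesgue" using A by (rule fmeasurableD)
    define F1 where "F1 y = indicator (ball x \<delta>) y * ennreal (norm (x - y) powr (\<alpha> - n))" for y
    have F1: "F1 \<in> borel_measurable lebesgue"
      unfolding F1_def
      by (auto intro!: borel_measurable_times_ennreal measurable_compose[OF _ measurable_ennreal]
          measurable_norm_powr_lebesgue borel_measurable_indicator)
    have pt: "ennreal (indicat_real A y * norm (x - y) powr (\<alpha> - n))
        \<le> F1 y + ennreal (\<delta> powr (\<alpha> - n)) * indicator A y" for y
    proof (cases "y \<in> ball x \<delta>")
      case True
      then have "ennreal (indicat_real A y * norm (x - y) powr (\<alpha> - n)) \<le> F1 y"
        by (auto simp: F1_def indicator_def)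
      then show ?thesis by (rule add_increasing2[rotated]) simp
    next
      case False
      then have "norm (x - y) powr (\<alpha> - n) \<le> \<delta> powr (\<alpha> - n)"
        using \<delta> \<alpha> by (intro powr_mono2') (auto simp: dist_norm n_def)
      then have "ennreal (indicat_real A y * norm (x - y) powr (\<alpha> - n)) \<le> ennreal (\<delta> powr (\<alpha> - n)) * indicator A y"
        by (auto simp: indicator_def intro!: ennreal_leI)
      then show ?thesis by (rule add_increasing[rotated]) simp
    qed
    have "riesz \<alpha> (indicat_real A) x
        \<le> (\<integral>\<^sup>+y. F1 y + ennreal (\<delta> powr (\<alpha> - n)) * indicator A y \<partial>lebesgue)"
      unfolding riesz_def n_def[symmetric] by (intro nn_integral_mono pt)
    also have "\<dots> = (\<integral>\<^sup>+y. F1 y \<partial>lebesgue) + ennreal (\<delta> powr (\<alpha> - n)) * emeasure lebesgue A"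
      using F1 Am by (subst nn_integral_add) (auto simp: nn_integral_cmult_indicator intro!: borel_measurable_times_ennreal)
    also have "\<dots> \<le> ennreal (C1 * \<delta> powr \<alpha>) + ennreal (\<delta> powr (\<alpha> - n)) * ennreal \<mu>"
      unfolding F1_def using A by (intro add_mono near \<delta>) (auto simp: emeasure_eq_measure2 \<mu>_def)
    also have "\<dots> = ennreal (C1 * \<delta> powr \<alpha> + \<delta> powr (\<alpha> - n) * \<mu>)"
      using C1 \<mu> by (simp add: ennreal_mult)
    also have "C1 * \<delta> powr \<alpha> + \<delta> powr (\<alpha> - n) * \<mu> = (C1 + 1) * \<mu> powr (\<alpha> / n)"
    proof -
      have "\<delta> powr (\<alpha> - n) * \<mu> = \<mu> powr ((\<alpha> - n) / n) * \<mu> powr 1"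
        using \<mu> by (simp add: \<delta>_def powr_powr)
      also have "\<dots> = \<mu> powr (\<alpha> / n)"
        unfolding powr_add[symmetric] using n by (simp add: field_simps)
      finally show ?thesis by (simp add: \<delta>_def powr_powr algebra_simps)
    qed
    finally show ?thesis by (simp add: \<mu>_def)
  qed
  with C1 show ?thesis unfolding n_def by (intro exI[of _ "C1 + 1"]) auto
qed

text \<open>Integrate the lower bound over \<open>A\<close> and move the potential onto the indicator of \<open>A\<close>.\<close>
lemma riesz_weak_type:
  assumes \<alpha>: "0 < \<alpha>" "\<alpha> < real DIM('a::euclidean_space)"
  shows "\<exists>C>0. \<forall>(A::'a set) g G \<mu>. A \<in> lmeasurable \<longrightarrow> g \<in> borel_measurable lebesgue \<longrightarrow>
    (\<forall>y. 0 \<le> g y) \<longrightarrow> 0 \<le> G \<longrightarrow> 0 \<le> \<mu> \<longrightarrow> (\<integral>\<^sup>+y. ennreal (g y) \<partial>lebesgue) \<le> ennreal G \<longrightarrow>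
    (\<forall>x\<in>A. ennreal \<mu> \<le> riesz \<alpha> g x) \<longrightarrow>
    \<mu> * measure lebesgue A powr (1 - \<alpha> / real DIM('a)) \<le> C * G"
proof -
  define n where "n = real DIM('a)"
  obtain C where C: "C > 0" and ind: "\<And>(A::'a set) x. A \<in> lmeasurable \<Longrightarrow>
    riesz \<alpha> (indicat_real A) x \<le> ennreal (C * measure lebesgue A powr (\<alpha> / n))"
    using riesz_indicator_le[OF \<alpha>] by (auto simp: n_def)
  have "\<mu> * measure lebesgue A powr (1 - \<alpha> / n) \<le> C * G"
    if A: "A \<in> lmeasurable" and g: "g \<in> borel_measurable lebesgue" "\<forall>y. 0 \<le> g y" and G: "0 \<le> G"
      and \<mu>: "0 \<le> \<mu>" and gG: "(\<integral>\<^sup>+y. ennreal (g y) \<partial>lebesgue) \<le> ennreal G"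
      and le: "\<forall>x\<in>A. ennreal \<mu> \<le> riesz \<alpha> g x" for A :: "'a set" and g G \<mu>
  proof -
    define M where "M = measure lebesgue A"
    have M: "emeasure lebesgue A = ennreal M" using A by (simp add: M_def emeasure_eq_measure2)
    have M0: "M \<ge> 0" by (simp add: M_def)
    have Am: "A \<in> sets lebesgue" using A by (rule fmeasurableD)
    interpret L: sigma_finite_measure "lebesgue :: 'a measure" by (rule sigma_finite_lebesgue)
    interpret P: pair_sigma_finite "lebesgue :: 'a measure" "lebesgue :: 'a measure" ..
    define H where "H p = ennreal (g (snd p)) * ennreal (indicat_real A (fst p) * norm (snd p - fst p) powr (\<alpha> - n))"
      for p :: "'a \<times> 'a"
    have H: "H \<in> borel_measurable (lebesgue \<Otimes>\<^sub>M lebesgue)"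
    proof -
      have 1: "(\<lambda>p. g (snd p)) \<in> borel_measurable (lebesgue \<Otimes>\<^sub>M lebesgue)"
        by (rule measurable_compose[OF measurable_snd g(1)])
      have "indicat_real A \<in> borel_measurable lebesgue" using Am by simp
      then have 2: "(\<lambda>p. indicat_real A (fst p)) \<in> borel_measurable (lebesgue \<Otimes>\<^sub>M lebesgue)"
        by (rule measurable_compose[OF measurable_fst])
      have 3: "(\<lambda>p. fst p) \<in> borel_measurable ((lebesgue::'a measure) \<Otimes>\<^sub>M (lebesgue::'a measure))"
        by (rule measurable_compose[OF measurable_fst ident_measurable_lebesgue])
      have 4: "(\<lambda>p. snd p) \<in> borel_measurable ((lebesgue::'a measure) \<Otimes>\<^sub>M (lebesgue::'a measure))"
        by (rule measurable_compose[OF measurable_snd ident_measurable_lebesgue])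
      have 5: "(\<lambda>p. norm (snd p - fst p)) \<in> borel_measurable ((lebesgue::'a measure) \<Otimes>\<^sub>M (lebesgue::'a measure))"
        by (rule measurable_compose[OF borel_measurable_diff[OF 4 3] borel_measurable_norm])
      show ?thesis unfolding H_def
        by (intro borel_measurable_times_ennreal measurable_compose[OF _ measurable_ennreal] 1 2 5
            borel_measurable_times powr_real_measurable borel_measurable_const)
    qed
    have "ennreal \<mu> * ennreal M = (\<integral>\<^sup>+x. ennreal \<mu> * indicator A x \<partial>lebesgue)"
      using Am by (simp add: M nn_integral_cmult_indicator)
    also have "\<dots> \<le> (\<integral>\<^sup>+x. (\<integral>\<^sup>+y. H (x, y) \<partial>lebesgue) \<partial>lebesgue)"
    proof (rule nn_integral_mono)
      fix x
      show "ennreal \<mu> * indicator A x \<le> (\<integral>\<^sup>+y. H (x, y) \<partial>lebesgue)"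
      proof (cases "x \<in> A")
        case True
        then have "ennreal \<mu> * indicator A x \<le> riesz \<alpha> g x" using le by simp
        also have "\<dots> = (\<integral>\<^sup>+y. H (x, y) \<partial>lebesgue)"
          unfolding riesz_def H_def using True g(2)
          by (intro nn_integral_cong) (simp add: ennreal_mult n_def norm_minus_commute)
        finally show ?thesis .
      qed simp
    qed
    also have "\<dots> = (\<integral>\<^sup>+y. (\<integral>\<^sup>+x. H (x, y) \<partial>lebesgue) \<partial>lebesgue)"
      using P.Fubini'[of "\<lambda>x y. H (x, y)"] H by simp
    also have "\<dots> \<le> (\<integral>\<^sup>+y. ennreal (g y) * ennreal (C * M powr (\<alpha> / n)) \<partial>lebesgue)"
    proof (rule nn_integral_mono)
      fix y
      have "(\<integral>\<^sup>+x. H (x, y) \<partial>lebesgue) = ennreal (g y) * riesz \<alpha> (indicat_real A) y"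
        unfolding H_def riesz_def n_def fst_conv snd_conv
        by (intro nn_integral_cmult measurable_riesz_integrand borel_measurable_indicator Am)
      also have "\<dots> \<le> ennreal (g y) * ennreal (C * M powr (\<alpha> / n))"
        unfolding M_def by (intro mult_left_mono ind A) simp
      finally show "(\<integral>\<^sup>+x. H (x, y) \<partial>lebesgue) \<le> ennreal (g y) * ennreal (C * M powr (\<alpha> / n))" .
    qed
    also have "\<dots> = (\<integral>\<^sup>+y. ennreal (g y) \<partial>lebesgue) * ennreal (C * M powr (\<alpha> / n))"
      by (intro nn_integral_multc measurable_compose[OF _ measurable_ennreal] g)
    also have "\<dots> \<le> ennreal G * ennreal (C * M powr (\<alpha> / n))"
      by (intro mult_right_mono gG) simp
    finally have "ennreal (\<mu> * M) \<le> ennreal (G * (C * M powr (\<alpha> / n)))"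
      using \<mu> G C M0 by (simp add: ennreal_mult)
    then have le': "\<mu> * M \<le> G * (C * M powr (\<alpha> / n))"
      using G C by (subst (asm) ennreal_le_iff) auto
    show ?thesis
    proof (cases "M = 0")
      case True
      then show ?thesis using C G by (simp add: M_def[symmetric])
    next
      case False
      then have Mp: "M > 0" using M0 by simp
      have "M powr (1 - \<alpha> / n) * M powr (\<alpha> / n) = M" using Mp by (simp add: powr_add[symmetric])
      then have "(\<mu> * M powr (1 - \<alpha> / n)) * M powr (\<alpha> / n) \<le> (C * G) * M powr (\<alpha> / n)"
        using le' by (simp add: mult_ac)
      then show ?thesis using Mp by (simp add: M_def[symmetric])
    qed
  qed
  with C show ?thesis unfolding n_def by blast
qed

section \<open>Superlevel sets\<close>

text \<open>Dominated convergence, since each point eventually leaves the sets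
  \<open>{y. real i < \<phi> y}\<close>. Taking for \<open>\<phi>\<close> the function itself cuts
  off large values; taking the norm cuts off a neighbourhood of infinity.\<close>

lemma nn_integral_superlevel_small:
  fixes g \<phi> :: "'a \<Rightarrow> real"
  assumes g: "integrable M g" "\<And>y. 0 \<le> g y" and \<phi>: "\<phi> \<in> borel_measurable M" and \<epsilon>: "0 < \<epsilon>"
  shows "\<exists>m>0. (\<integral>\<^sup>+y. ennreal (g y * indicat_real {y. m < \<phi> y} y) \<partial>M) \<le> ennreal \<epsilon>"
proof -
  define G where "G i y = g y * indicat_real {y. real i < \<phi> y} y" for i y
  have gm: "g \<in> borel_measurable M" using g(1) by auto
  have Gm: "G i \<in> borel_measurable M" for i
  proof -
    have "G i = (\<lambda>y. if real i < \<phi> y then g y else 0)" by (auto simp: G_def)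
    then show ?thesis using gm \<phi> by simp
  qed
  have "(\<lambda>i. \<integral>y. G i y \<partial>M) \<longlonglongrightarrow> (\<integral>y. 0 \<partial>M)"
  proof (rule integral_dominated_convergence[where w = g])
    show "AE y in M. (\<lambda>i. G i y) \<longlonglongrightarrow> 0"
    proof (rule AE_I2)
      fix y
      obtain k where "\<phi> y < real k" using reals_Archimedean2 by blast
      then have "\<forall>\<^sub>F i in sequentially. G i y = 0"
        by (intro eventually_sequentiallyI[of k]) (auto simp: G_def indicator_def)
      then show "(\<lambda>i. G i y) \<longlonglongrightarrow> 0" by (rule tendsto_eventually)
    qed
    show "AE y in M. norm (G i y) \<le> g y" for i
      using g(2) by (auto simp: G_def indicator_def)
  qed (use g Gm in auto)
  then have "\<forall>\<^sub>F i in sequentially. (\<integral>y. G i y \<partial>M) < \<epsilon>"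
    using \<epsilon> by (intro order_tendstoD(2)) auto
  then obtain k where k: "\<And>i. i \<ge> k \<Longrightarrow> (\<integral>y. G i y \<partial>M) < \<epsilon>"
    by (auto simp: eventually_sequentially)
  \<comment> \<open>The successor guarantees that the level is positive.\<close>
  define i where "i = Suc k"
  have Gi: "integrable M (G i)"
    by (rule Bochner_Integration.integrable_bound[OF g(1)])
      (use Gm g(2) in \<open>auto simp: G_def indicator_def\<close>)
  have "(\<integral>\<^sup>+y. ennreal (G i y) \<partial>M) = ennreal (\<integral>y. G i y \<partial>M)"
    using g(2) by (intro nn_integral_eq_integral[OF Gi]) (auto simp: G_def)
  also have "\<dots> \<le> ennreal \<epsilon>" using k[of i] by (intro ennreal_leI) (simp add: i_def)
  finally show ?thesis by (intro exI[of _ "real i"]) (simp add: i_def G_def)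
qed

lemma superlevel_measurable:
  assumes "f \<in> borel_measurable lebesgue"
  shows "{y. (s::real) < f y} \<in> sets lebesgue"
  using borel_measurable_less[OF borel_measurable_const[of s] assms] by simp

text \<open>The bound \<open>E\<close> concerns only the integral over the superlevel set itself, so
  smallness of a tail passes to the measure.\<close>

lemma superlevel_Chebyshev:
  fixes f :: "'a::euclidean_space \<Rightarrow> real"
  assumes f: "f \<in> borel_measurable lebesgue" and s: "0 < s" and \<sigma>: "0 < \<sigma>"
    and E: "(\<integral>\<^sup>+y. ennreal (f y powr \<sigma> * indicat_real {y. s < f y} y) \<partial>lebesgue) \<le> ennreal E" "0 \<le> E"
  shows "{y. s < f y} \<in> lmeasurable" "s powr \<sigma> * measure lebesgue {y. s < f y} \<le> E"
proof -
  have S: "{y. s < f y} \<in> sets lebesgue" by (rule superlevel_measurable[OF f])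
  have "ennreal (s powr \<sigma>) * emeasure lebesgue {y. s < f y} = (\<integral>\<^sup>+y. ennreal (s powr \<sigma>) * indicator {y. s < f y} y \<partial>lebesgue)"
    using S by (simp add: nn_integral_cmult_indicator)
  also have "\<dots> \<le> (\<integral>\<^sup>+y. ennreal (f y powr \<sigma> * indicat_real {y. s < f y} y) \<partial>lebesgue)"
    using s \<sigma> by (intro nn_integral_mono) (auto simp: indicator_def intro!: ennreal_leI powr_mono2)
  also note E(1)
  finally have *: "ennreal (s powr \<sigma>) * emeasure lebesgue {y. s < f y} \<le> ennreal E" .
  have "emeasure lebesgue {y. s < f y} \<noteq> \<infinity>"
  proof
    assume "emeasure lebesgue {y. s < f y} = \<infinity>"
    with * s show False by (simp add: ennreal_mult_top top_unique)
  qed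
  then show L: "{y. s < f y} \<in> lmeasurable" using S by (simp add: fmeasurable_def top.not_eq_extremum)
  have "ennreal (s powr \<sigma> * measure lebesgue {y. s < f y}) \<le> ennreal E"
    using * L by (simp add: ennreal_mult emeasure_eq_measure2)
  then show "s powr \<sigma> * measure lebesgue {y. s < f y} \<le> E" using E(2) by simp
qed

text \<open>A weak L^sigma tail controls the L^1 tail: where \<open>f\<close> lies between
  \<open>h * 2 ^ j\<close> and twice that value, the mass is at most a multiple of
  \<open>N * (h * 2 ^ j) powr (1 - \<sigma>)\<close>, and these bounds form a convergent geometric
  series because \<open>\<sigma> > 1\<close>.\<close>

lemma nn_integral_superlevel_le:
  fixes f :: "'a::euclidean_space \<Rightarrow> real"
  assumes \<sigma>: "1 < \<sigma>" and f: "f \<in> borel_measurable lebesgue" and h: "0 < h" and N: "0 \<le> N"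
    and lm: "\<And>s. h \<le> s \<Longrightarrow> {y. s < f y} \<in> lmeasurable"
    and tail: "\<And>s. h \<le> s \<Longrightarrow> s powr \<sigma> * measure lebesgue {y. s < f y} \<le> N"
  shows "(\<integral>\<^sup>+y. ennreal (f y * indicat_real {y. h < f y} y) \<partial>lebesgue)
    \<le> ennreal (2 / (1 - 2 powr (1 - \<sigma>)) * h powr (1 - \<sigma>) * N)"
proof -
  define S where "S j = {y. h * 2 ^ j < f y}" for j :: nat
  define F where "F j y = ennreal (2 * (h * 2 ^ j)) * indicator (S j) y" for j y
  have hj: "h \<le> h * 2 ^ j" for j :: nat using h by simp
  have S: "S j \<in> lmeasurable" for j unfolding S_def by (rule lm[OF hj])
  then have Sm: "S j \<in> sets lebesgue" for j by (rule fmeasurableD)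
  have F: "F j \<in> borel_measurable lebesgue" for j
    unfolding F_def by (intro borel_measurable_times_ennreal borel_measurable_const borel_measurable_indicator Sm)
  define T where "T = (2::real) powr (1 - \<sigma>)"
  have T: "0 < T" "T < 1" using \<sigma> powr_less_mono[of "1 - \<sigma>" 0 2] by (auto simp: T_def)
  have pt: "ennreal (f y * indicat_real {y. h < f y} y) \<le> (\<Sum>j. F j y)" for y
  proof (cases "h < f y")
    case True
    have ex: "\<exists>j::nat. f y \<le> 2 * (h * 2 ^ j)"
    proof -
      obtain j where "f y / h < 2 ^ j" using real_arch_pow[of 2 "f y / h"] by auto
      then have "f y < h * 2 ^ j" using h by (simp add: pos_divide_less_eq mult.commute)
      moreover have "0 \<le> h * 2 ^ j" using h by simp
      ultimately show ?thesis by (intro exI[of _ j]) simp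
    qed
    define j where "j = (LEAST j. f y \<le> 2 * (h * 2 ^ j))"
    have j: "f y \<le> 2 * (h * 2 ^ j)" unfolding j_def by (rule LeastI_ex[OF ex])
    have "h * 2 ^ j < f y"
    proof (cases j)
      case 0
      then show ?thesis using True by simp
    next
      case (Suc i)
      then have "\<not> f y \<le> 2 * (h * 2 ^ i)"
        using not_less_Least[of i "\<lambda>j. f y \<le> 2 * (h * 2 ^ j)"] by (auto simp: j_def)
      then show ?thesis using Suc by simp
    qed
    then have "ennreal (f y * indicat_real {y. h < f y} y) \<le> F j y"
      using j True by (auto simp: F_def S_def intro!: ennreal_leI)
    also have "\<dots> \<le> (\<Sum>j. F j y)"
      using sum_le_suminf[of "\<lambda>j. F j y" "{j}"] by simp
    finally show ?thesis .
  qed simp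
  have intF: "(\<integral>\<^sup>+y. F j y \<partial>lebesgue) \<le> ennreal (2 * h powr (1 - \<sigma>) * N * T ^ j)" for j
  proof -
    define s where "s = h * 2 ^ j"
    have s: "s > 0" "h \<le> s" using h hj by (auto simp: s_def)
    have "(\<integral>\<^sup>+y. F j y \<partial>lebesgue) = ennreal (2 * s * measure lebesgue (S j))"
      using S[of j] Sm[of j] s unfolding F_def s_def
      by (simp add: nn_integral_cmult_indicator emeasure_eq_measure2 ennreal_mult)
    also have "\<dots> \<le> ennreal (2 * s powr (1 - \<sigma>) * N)"
    proof (rule ennreal_leI)
      have "2 * s * measure lebesgue (S j) = 2 * s powr (1 - \<sigma>) * (s powr \<sigma> * measure lebesgue (S j))"
        using s by (simp add: powr_diff)
      also have "\<dots> \<le> 2 * s powr (1 - \<sigma>) * N"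
        using tail[OF s(2)] by (intro mult_left_mono) (auto simp: S_def s_def)
      finally show "2 * s * measure lebesgue (S j) \<le> 2 * s powr (1 - \<sigma>) * N" .
    qed
    also have "s powr (1 - \<sigma>) = h powr (1 - \<sigma>) * T ^ j"
    proof -
      have "(2 ^ j) powr (1 - \<sigma>) = ((2::real) powr real j) powr (1 - \<sigma>)" by (simp add: powr_realpow)
      also have "\<dots> = T powr real j" by (simp add: T_def powr_powr mult.commute)
      also have "\<dots> = T ^ j" using T by (simp add: powr_realpow)
      finally show ?thesis using h by (simp add: s_def powr_mult)
    qed
    finally show ?thesis by (simp add: mult_ac)
  qed
  have "(\<integral>\<^sup>+y. ennreal (f y * indicat_real {y. h < f y} y) \<partial>lebesgue) \<le> (\<integral>\<^sup>+y. (\<Sum>j. F j y) \<partial>lebesgue)"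
    by (intro nn_integral_mono pt)
  also have "\<dots> = (\<Sum>j. \<integral>\<^sup>+y. F j y \<partial>lebesgue)" using F by (intro nn_integral_suminf) auto
  also have "\<dots> \<le> (\<Sum>j. ennreal (2 * h powr (1 - \<sigma>) * N * T ^ j))"
    by (intro suminf_le intF) auto
  also have "\<dots> = ennreal (2 * h powr (1 - \<sigma>) * N * (1 / (1 - T)))"
    using T N by (intro suminf_ennreal_eq sums_mult geometric_sums) auto
  finally show ?thesis by (simp add: T_def mult_ac)
qed

text \<open>The levels match by scaling: a function of size \<open>l powr (a + \<alpha>)\<close> on
  a ball of radius \<open>1 / l\<close> has potential of order \<open>l powr a\<close> there. The
  constants do not depend on \<open>A\<close>, \<open>N\<close> or \<open>l\<close>, which is what
  allows iteration.\<close>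

lemma riesz_superlevel_step:
  fixes \<alpha> \<sigma> :: real and f :: "'a::euclidean_space \<Rightarrow> real"
  defines "n \<equiv> real DIM('a)"
  defines "a \<equiv> n / \<sigma> - \<alpha>"
  assumes \<alpha>: "0 < \<alpha>" and \<sigma>: "1 < \<sigma>" and \<alpha>\<sigma>: "\<alpha> * \<sigma> < n"
    and f: "f \<in> borel_measurable lebesgue" "\<And>y. 0 \<le> f y" and fint: "integrable lebesgue (\<lambda>y. f y powr \<sigma>)"
  shows "\<exists>C>0. \<exists>l\<^sub>1>0. \<forall>l\<ge>l\<^sub>1. \<forall>A\<in>lmeasurable. \<forall>N\<ge>0.
    (\<forall>x\<in>A. ennreal (l powr a) \<le> riesz \<alpha> f x) \<longrightarrow>
    (\<forall>s\<ge>l. s powr n * measure lebesgue {y. s powr (a + \<alpha>) < f y} \<le> N) \<longrightarrow>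
    l powr n * measure lebesgue A \<le> (C * N) powr (n / (n - \<alpha>))"
proof -
  have n: "n = (a + \<alpha>) * \<sigma>" using \<sigma> by (simp add: a_def)
  have n0: "n > 0" by (simp add: n_def)
  have \<alpha>n: "\<alpha> < n" using \<alpha> \<sigma> \<alpha>\<sigma> mult_strict_left_mono[of 1 \<sigma> \<alpha>] by linarith
  have a: "a > 0" using \<alpha>\<sigma> \<sigma> by (simp add: a_def field_simps)
  define I where "I = (\<integral>y. f y powr \<sigma> \<partial>lebesgue)"
  have I: "I \<ge> 0" "(\<integral>\<^sup>+y. ennreal (f y powr \<sigma>) \<partial>lebesgue) = ennreal I"
    unfolding I_def using fint by (auto intro!: nn_integral_eq_integral)
  have sub: "(\<integral>\<^sup>+y. ennreal ((f y * indicat_real S y) powr \<sigma>) \<partial>lebesgue) \<le> ennreal I" for S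
    unfolding I(2)[symmetric] using \<sigma> by (intro nn_integral_mono) (auto simp: indicator_def)
  have fl: "{y. s < f y} \<in> lmeasurable" if "s > 0" for s
  proof -
    have "(f y * indicat_real S y) powr \<sigma> = f y powr \<sigma> * indicat_real S y" for S y
      by (cases "y \<in> S") auto
    then show ?thesis
      using \<sigma> that I(1) sub[of "{y. s < f y}"] f(1)
      by (intro superlevel_Chebyshev(1)[where E = I and \<sigma> = \<sigma>]) auto
  qed
  obtain C0 where C0: "C0 > 0" and split: "\<And>(f::'a \<Rightarrow> real) m E x \<delta> \<theta>.
    f \<in> borel_measurable lebesgue \<Longrightarrow> (\<forall>y. 0 \<le> f y) \<Longrightarrow> (AE y in lebesgue. f y \<le> m) \<Longrightarrow> 0 \<le> m \<Longrightarrow>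
    0 \<le> E \<Longrightarrow> (\<integral>\<^sup>+y. ennreal (f y powr \<sigma>) \<partial>lebesgue) \<le> ennreal E \<Longrightarrow> 0 < \<delta> \<Longrightarrow> 0 < \<theta> \<Longrightarrow>
    riesz \<alpha> f x \<le> ennreal (C0 * m * \<delta> powr \<alpha> + (C0 * \<theta> + \<theta> powr (1 - \<sigma>) * E) * \<delta> powr (- a))"
    using riesz_le_split[where 'a='a, OF \<alpha> \<sigma>] \<alpha>\<sigma> unfolding a_def n_def by blast
  obtain Cw where Cw: "Cw > 0" and weak: "\<And>(A::'a set) g G \<mu>. A \<in> lmeasurable \<Longrightarrow> g \<in> borel_measurable lebesgue \<Longrightarrow>
    (\<forall>y. 0 \<le> g y) \<Longrightarrow> 0 \<le> G \<Longrightarrow> 0 \<le> \<mu> \<Longrightarrow> (\<integral>\<^sup>+y. ennreal (g y) \<partial>lebesgue) \<le> ennreal G \<Longrightarrow>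
    (\<forall>x\<in>A. ennreal \<mu> \<le> riesz \<alpha> g x) \<Longrightarrow>
    \<mu> * measure lebesgue A powr (1 - \<alpha> / n) \<le> Cw * G"
    using riesz_weak_type[where 'a='a, OF \<alpha>] \<alpha>n unfolding n_def by blast
  \<comment> \<open>The middle part is estimated with splitting radius \<open>\<kappa> / l\<close>,
    at which all terms scale like \<open>l powr a\<close>. The constants \<open>\<kappa>\<close>,
    \<open>\<theta>\<close> and \<open>E0\<close>, chosen in this order, give the coefficients 1/8,
    1/16 and 1/16, with sum 1/4. The level \<open>m\<close> then makes the middle part have
    \<open>\<sigma>\<close>-mass at most \<open>E0\<close>; none of these choices involves
    \<open>l\<close>.\<close>
  define \<kappa> where "\<kappa> = (1 / (8 * C0)) powr (1 / \<alpha>)"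
  have \<kappa>: "\<kappa> > 0" "C0 * \<kappa> powr \<alpha> = 1 / 8" using C0 \<alpha> by (auto simp: \<kappa>_def powr_powr)
  define \<theta> where "\<theta> = 1 / (16 * C0 * \<kappa> powr (- a))"
  have \<theta>: "\<theta> > 0" "C0 * \<theta> * \<kappa> powr (- a) = 1 / 16" using C0 \<kappa> by (auto simp: \<theta>_def)
  define E0 where "E0 = 1 / (16 * \<theta> powr (1 - \<sigma>) * \<kappa> powr (- a))"
  have E0: "E0 > 0" "\<theta> powr (1 - \<sigma>) * E0 * \<kappa> powr (- a) = 1 / 16" using \<theta>(1) \<kappa> by (auto simp: E0_def)
  obtain m where m: "m > 0" "(\<integral>\<^sup>+y. ennreal (f y powr \<sigma> * indicat_real {y. m < f y} y) \<partial>lebesgue) \<le> ennreal E0"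
    using nn_integral_superlevel_small[OF fint _ f(1) E0(1)] by auto
  \<comment> \<open>Bound for the potential of the low part, from radius and weight parameter both
    equal to 1.\<close>
  define K where "K = C0 * m + (C0 + I)"
  have K: "K > 0" using C0 m I by (simp add: K_def add_pos_nonneg)
  \<comment> \<open>The first entry ensures \<open>4 * K \<le> l powr a\<close>; the second puts the
    two truncation levels in order, \<open>m \<le> h\<close>.\<close>
  define l1 where "l1 = max ((4 * K) powr (1 / a)) (m powr (1 / (a + \<alpha>)))"
  have l1: "l1 > 0" using K by (simp add: l1_def less_max_iff_disj)
  define CG where "CG = 2 / (1 - 2 powr (1 - \<sigma>))"
  have CG: "CG > 0" using \<sigma> powr_less_mono[of "1 - \<sigma>" 0 2] by (simp add: CG_def)
  define C where "C = 2 * Cw * CG"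
  have C: "C > 0" using Cw CG by (simp add: C_def)
  have "l powr n * measure lebesgue A \<le> (C * N) powr (n / (n - \<alpha>))"
    if l: "l \<ge> l1" and A: "A \<in> lmeasurable" and N: "N \<ge> 0"
      and low: "\<forall>x\<in>A. ennreal (l powr a) \<le> riesz \<alpha> f x"
      and tail: "\<forall>s\<ge>l. s powr n * measure lebesgue {y. s powr (a + \<alpha>) < f y} \<le> N" for l A N
  proof -
    have l0: "l > 0" using l l1 by simp
    define h where "h = l powr (a + \<alpha>)"
    have h: "h > 0" using l0 by (simp add: h_def)
    have la: "4 * K \<le> l powr a"
    proof -
      have "4 * K = ((4 * K) powr (1 / a)) powr a" using a K by (simp add: powr_powr)
      also have "\<dots> \<le> l powr a" using l a by (intro powr_mono2) (auto simp: l1_def)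
      finally show ?thesis .
    qed
    have mh: "m \<le> h"
    proof -
      have "m = (m powr (1 / (a + \<alpha>))) powr (a + \<alpha>)" using a \<alpha> m by (simp add: powr_powr)
      also have "\<dots> \<le> h" unfolding h_def using l a \<alpha> by (intro powr_mono2) (auto simp: l1_def)
      finally show ?thesis .
    qed
    have hm: "{y. s < f y} \<in> sets lebesgue" for s by (rule superlevel_measurable[OF f(1)])
    define f1 where "f1 y = f y * indicat_real (- {y. m < f y}) y" for y
    define f2 where "f2 y = f y * indicat_real ({y. m < f y} - {y. h < f y}) y" for y
    define f3 where "f3 y = f y * indicat_real {y. h < f y} y" for y
    have fm: "f1 \<in> borel_measurable lebesgue" "f2 \<in> borel_measurable lebesgue" "f3 \<in> borel_measurable lebesgue"
      unfolding f1_def f2_def f3_def using hm f(1)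
      by (auto intro!: borel_measurable_times borel_measurable_indicator sets.Diff)
    have f0: "f1 y \<ge> 0" "f2 y \<ge> 0" "f3 y \<ge> 0" for y using f(2) by (auto simp: f1_def f2_def f3_def)
    have feq: "f = (\<lambda>y. f1 y + (f2 y + f3 y))"
      using mh by (auto simp: f1_def f2_def f3_def indicator_def)
    have r1: "riesz \<alpha> f1 x \<le> ennreal (l powr a / 4)" for x
    proof -
      have "riesz \<alpha> f1 x \<le> ennreal (C0 * m * 1 powr \<alpha> + (C0 * 1 + 1 powr (1 - \<sigma>) * I) * 1 powr (- a))"
        using m fm f0 I(1) unfolding f1_def by (intro split sub) (auto simp: indicator_def)
      also have "\<dots> \<le> ennreal (l powr a / 4)" using la by (intro ennreal_leI) (simp add: K_def)
      finally show ?thesis .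
    qed
    have r2: "riesz \<alpha> f2 x \<le> ennreal (l powr a / 4)" for x
    proof -
      have e2: "(\<integral>\<^sup>+y. ennreal (f2 y powr \<sigma>) \<partial>lebesgue) \<le> ennreal E0"
        using m(2) by (rule order.trans[rotated]) (auto intro!: nn_integral_mono simp: f2_def indicator_def)
      have "riesz \<alpha> f2 x \<le> ennreal (C0 * h * (\<kappa> / l) powr \<alpha> + (C0 * \<theta> + \<theta> powr (1 - \<sigma>) * E0) * (\<kappa> / l) powr (- a))"
        using fm f0 h E0(1) \<kappa> \<theta> l0 e2 by (intro split) (auto simp: f2_def indicator_def)
      also have "C0 * h * (\<kappa> / l) powr \<alpha> = (C0 * \<kappa> powr \<alpha>) * l powr a"
        using l0 \<kappa>(1) by (simp add: h_def powr_divide powr_add)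
      also have "(C0 * \<theta> + \<theta> powr (1 - \<sigma>) * E0) * (\<kappa> / l) powr (- a)
          = (C0 * \<theta> * \<kappa> powr (- a) + \<theta> powr (1 - \<sigma>) * E0 * \<kappa> powr (- a)) * l powr a"
        using l0 \<kappa>(1) by (simp add: powr_divide powr_minus field_simps)
      finally show ?thesis unfolding \<kappa>(2) \<theta>(2) E0(2) by simp
    qed
    have r3: "ennreal (l powr a / 2) \<le> riesz \<alpha> f3 x" if "x \<in> A" for x
    proof -
      \<comment> \<open>Written as two halves so that the finite half absorbed by the first two
        parts can be cancelled in \<open>ennreal\<close>.\<close>
      have "ennreal (l powr a / 2) + ennreal (l powr a / 2) = ennreal (l powr a)"
        by (subst ennreal_plus[symmetric]) auto
      also have "\<dots> \<le> riesz \<alpha> f x" using low that by blast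
      also have "riesz \<alpha> f x = riesz \<alpha> f1 x + (riesz \<alpha> f2 x + riesz \<alpha> f3 x)"
        unfolding feq using fm f0 by (subst riesz_add, simp_all)+
      also have "\<dots> \<le> ennreal (l powr a / 4) + (ennreal (l powr a / 4) + riesz \<alpha> f3 x)"
        by (intro add_mono r1 r2 order.refl)
      also have "\<dots> = ennreal (l powr a / 2) + riesz \<alpha> f3 x"
        by (simp add: add.assoc[symmetric] ennreal_plus[symmetric] del: ennreal_plus)
      finally show ?thesis by simp
    qed
    define G where "G = CG * h powr (1 - \<sigma>) * N"
    have G0: "G \<ge> 0" using CG N by (simp add: G_def)
    have "(\<integral>\<^sup>+y. ennreal (f3 y) \<partial>lebesgue) \<le> ennreal G"
      unfolding f3_def G_def CG_def
    proof (rule nn_integral_superlevel_le[OF \<sigma> f(1) h N])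
      fix s assume s: "h \<le> s"
      show "{y. s < f y} \<in> lmeasurable" using s h by (intro fl) simp
      \<comment> \<open>Reparametrizing the levels of \<open>f\<close> by
        \<open>s = t powr (a + \<alpha>)\<close> gives \<open>t powr n = s powr \<sigma>\<close>,
        which turns the hypothesis on \<open>N\<close> into a weak L^sigma tail.\<close>
      define t where "t = s powr (1 / (a + \<alpha>))"
      have ts: "t powr (a + \<alpha>) = s" using s h a \<alpha> by (simp add: t_def powr_powr)
      have tn: "t powr n = s powr \<sigma>" unfolding n powr_powr[symmetric] ts ..
      have "l = h powr (1 / (a + \<alpha>))" using l0 a \<alpha> by (simp add: h_def powr_powr)
      also have "\<dots> \<le> t" unfolding t_def using s h a \<alpha> by (intro powr_mono2) auto
      finally have "l \<le> t" .
      then have "t powr n * measure lebesgue {y. t powr (a + \<alpha>) < f y} \<le> N" using tail by blast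
      then show "s powr \<sigma> * measure lebesgue {y. s < f y} \<le> N" unfolding ts tn .
    qed
    with A fm f0 G0 r3 have "l powr a / 2 * measure lebesgue A powr (1 - \<alpha> / n) \<le> Cw * G"
      by (intro weak[of A f3]) auto
    then have w: "l powr a * measure lebesgue A powr (1 - \<alpha> / n) \<le> C * N * h powr (1 - \<sigma>)"
      by (simp add: G_def C_def mult_ac)
    \<comment> \<open>Since \<open>n = (a + \<alpha>) * \<sigma>\<close>, the loss from the
      truncation level is exactly \<open>l powr (a + \<alpha> - n)\<close>. After multiplication by
      its reciprocal no power of \<open>l\<close> is left on the right-hand side.\<close>
    have hl: "h powr (1 - \<sigma>) * l powr (n - \<alpha> - a) = 1"
    proof -
      have "(a + \<alpha>) * (1 - \<sigma>) + (n - \<alpha> - a) = 0" by (simp add: n algebra_simps)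
      then show ?thesis using l0 by (simp add: h_def powr_powr powr_add[symmetric])
    qed
    have "l powr (n - \<alpha>) * measure lebesgue A powr (1 - \<alpha> / n)
        = l powr a * measure lebesgue A powr (1 - \<alpha> / n) * l powr (n - \<alpha> - a)"
      using l0 by (simp add: powr_add[symmetric] mult_ac)
    also have "\<dots> \<le> C * N * h powr (1 - \<sigma>) * l powr (n - \<alpha> - a)"
      by (intro mult_right_mono w) simp
    also have "\<dots> = C * N" using hl by (simp add: mult.assoc)
    finally have le: "l powr (n - \<alpha>) * measure lebesgue A powr (1 - \<alpha> / n) \<le> C * N" .
    have "l powr n * measure lebesgue A
        = (l powr (n - \<alpha>) * measure lebesgue A powr (1 - \<alpha> / n)) powr (n / (n - \<alpha>))"
    proof -
      have "(1 - \<alpha> / n) * (n / (n - \<alpha>)) = 1" using n0 \<alpha>n by (simp add: field_simps)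
      then show ?thesis using \<alpha>n l0 n0 by (simp add: powr_mult powr_powr)
    qed
    also have "\<dots> \<le> (C * N) powr (n / (n - \<alpha>))"
      using le l0 \<alpha>n n0 by (intro powr_mono2) auto
    finally show ?thesis .
  qed
  with C l1 show ?thesis by blast
qed

section \<open>Boundedness and decay\<close>

lemma riesz_cmult:
  fixes f :: "'a::euclidean_space \<Rightarrow> real"
  assumes "f \<in> borel_measurable lebesgue" "0 \<le> c"
  shows "riesz \<alpha> (\<lambda>y. c * f y) x = ennreal c * riesz \<alpha> f x"
proof -
  have "riesz \<alpha> (\<lambda>y. c * f y) x
      = (\<integral>\<^sup>+y. ennreal c * ennreal (f y * norm (x - y) powr (\<alpha> - real DIM('a))) \<partial>lebesgue)"
    unfolding riesz_def using assms(2) by (intro nn_integral_cong) (simp add: ennreal_mult' mult.assoc)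
  also have "\<dots> = ennreal c * riesz \<alpha> f x"
    unfolding riesz_def by (intro nn_integral_cmult measurable_riesz_integrand assms(1))
  finally show ?thesis .
qed

lemma riesz_indicator_far:
  fixes A :: "'a::euclidean_space set"
  assumes A: "A \<in> lmeasurable" "A \<subseteq> cball 0 R" and \<rho>: "0 < \<rho>" and x: "R + \<rho> \<le> norm x"
    and \<alpha>: "\<alpha> < real DIM('a)"
  shows "riesz \<alpha> (indicat_real A) x \<le> ennreal (\<rho> powr (\<alpha> - real DIM('a)) * measure lebesgue A)"
proof -
  have "riesz \<alpha> (indicat_real A) x \<le> (\<integral>\<^sup>+y. ennreal (\<rho> powr (\<alpha> - real DIM('a))) * indicator A y \<partial>lebesgue)"
    unfolding riesz_def
  proof (rule nn_integral_mono)
    fix y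
    show "ennreal (indicat_real A y * norm (x - y) powr (\<alpha> - real DIM('a)))
      \<le> ennreal (\<rho> powr (\<alpha> - real DIM('a))) * indicator A y"
    proof (cases "y \<in> A")
      case True
      then have "norm y \<le> R" using A(2) by auto
      then have "\<rho> \<le> norm (x - y)" using x norm_triangle_ineq2[of x y] by linarith
      then have "norm (x - y) powr (\<alpha> - real DIM('a)) \<le> \<rho> powr (\<alpha> - real DIM('a))"
        using \<rho> \<alpha> by (intro powr_mono2') auto
      then show ?thesis using True by (simp add: ennreal_leI)
    qed simp
  qed
  also have "\<dots> = ennreal (\<rho> powr (\<alpha> - real DIM('a)) * measure lebesgue A)"
    using A(1) fmeasurableD[OF A(1)]
    by (simp add: nn_integral_cmult_indicator emeasure_eq_measure2 ennreal_mult)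
  finally show ?thesis .
qed

text \<open>The instance of \<open>riesz_le_split\<close> with radius and weight parameter both
  equal to 1.\<close>

lemma riesz_bounded:
  fixes f :: "'a::euclidean_space \<Rightarrow> real"
  assumes \<alpha>: "0 < \<alpha>" and \<sigma>: "1 < \<sigma>" and \<alpha>\<sigma>: "\<alpha> * \<sigma> < real DIM('a)"
    and f: "f \<in> borel_measurable lebesgue" "\<And>y. 0 \<le> f y" and fint: "integrable lebesgue (\<lambda>y. f y powr \<sigma>)"
    and m: "AE y in lebesgue. f y \<le> m" "0 \<le> m"
  shows "\<exists>K\<ge>0. \<forall>x. riesz \<alpha> f x \<le> ennreal K"
proof -
  define I where "I = (\<integral>y. f y powr \<sigma> \<partial>lebesgue)"
  have I: "I \<ge> 0" "(\<integral>\<^sup>+y. ennreal (f y powr \<sigma>) \<partial>lebesgue) = ennreal I"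
    unfolding I_def using fint by (auto intro!: nn_integral_eq_integral)
  obtain C where "C > 0" "\<And>(f::'a \<Rightarrow> real) m E x \<delta> \<theta>.
    f \<in> borel_measurable lebesgue \<Longrightarrow> (\<forall>y. 0 \<le> f y) \<Longrightarrow> (AE y in lebesgue. f y \<le> m) \<Longrightarrow> 0 \<le> m \<Longrightarrow>
    0 \<le> E \<Longrightarrow> (\<integral>\<^sup>+y. ennreal (f y powr \<sigma>) \<partial>lebesgue) \<le> ennreal E \<Longrightarrow> 0 < \<delta> \<Longrightarrow> 0 < \<theta> \<Longrightarrow>
    riesz \<alpha> f x \<le> ennreal (C * m * \<delta> powr \<alpha>
      + (C * \<theta> + \<theta> powr (1 - \<sigma>) * E) * \<delta> powr (- (real DIM('a) / \<sigma> - \<alpha>)))"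
    using riesz_le_split[where 'a='a, OF \<alpha> \<sigma> \<alpha>\<sigma>] by blast
  from this(2)[OF f(1) _ m I(1), of 1 1] f(2) I(2) this(1) m I(1) show ?thesis
    by (intro exI[of _ "C * m + (C + I)"]) auto
qed

text \<open>Almost everywhere \<open>f\<close> is dominated by its part below a small level plus
  \<open>m\<close> times the indicator of a set of finite measure. That set splits into a piece of
  small measure, whose potential is small everywhere, and a bounded piece, whose potential decays
  with the distance.\<close>

lemma riesz_tendsto_0:
  fixes f w :: "'a::euclidean_space \<Rightarrow> real"
  assumes \<alpha>: "0 < \<alpha>" and \<sigma>: "1 < \<sigma>" and \<alpha>\<sigma>: "\<alpha> * \<sigma> < real DIM('a)"
    and f: "f \<in> borel_measurable lebesgue" "\<And>y. 0 \<le> f y" and fint: "integrable lebesgue (\<lambda>y. f y powr \<sigma>)"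
    and m: "AE y in lebesgue. f y \<le> m" "0 < m"
    and w: "\<And>x. 0 \<le> w x" "\<And>x. ennreal (w x) = riesz \<alpha> f x"
  shows "(w \<longlongrightarrow> 0) at_infinity"
  unfolding Lim_at_infinity
proof (intro allI impI)
  fix \<epsilon> :: real
  assume \<epsilon>: "0 < \<epsilon>"
  define n where "n = real DIM('a)"
  define a where "a = n / \<sigma> - \<alpha>"
  have n0: "n > 0" by (simp add: n_def)
  have \<alpha>n: "\<alpha> < n" using \<alpha> \<sigma> \<alpha>\<sigma> mult_strict_left_mono[of 1 \<sigma> \<alpha>] unfolding n_def by linarith
  have a: "a > 0" using \<alpha>\<sigma> \<sigma> by (simp add: a_def n_def field_simps)
  define I where "I = (\<integral>y. f y powr \<sigma> \<partial>lebesgue)"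
  have I: "I \<ge> 0" "(\<integral>\<^sup>+y. ennreal (f y powr \<sigma>) \<partial>lebesgue) = ennreal I"
    unfolding I_def using fint by (auto intro!: nn_integral_eq_integral)
  have sub: "(\<integral>\<^sup>+y. ennreal ((f y * indicat_real S y) powr \<sigma>) \<partial>lebesgue) \<le> ennreal I" for S
    unfolding I(2)[symmetric] using \<sigma> by (intro nn_integral_mono) (auto simp: indicator_def)
  obtain C where C: "C > 0" and split: "\<And>(f::'a \<Rightarrow> real) m E x \<delta> \<theta>.
    f \<in> borel_measurable lebesgue \<Longrightarrow> (\<forall>y. 0 \<le> f y) \<Longrightarrow> (AE y in lebesgue. f y \<le> m) \<Longrightarrow> 0 \<le> m \<Longrightarrow>
    0 \<le> E \<Longrightarrow> (\<integral>\<^sup>+y. ennreal (f y powr \<sigma>) \<partial>lebesgue) \<le> ennreal E \<Longrightarrow> 0 < \<delta> \<Longrightarrow> 0 < \<theta> \<Longrightarrow>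
    riesz \<alpha> f x \<le> ennreal (C * m * \<delta> powr \<alpha> + (C * \<theta> + \<theta> powr (1 - \<sigma>) * E) * \<delta> powr (- a))"
    using riesz_le_split[where 'a='a, OF \<alpha> \<sigma> \<alpha>\<sigma>] unfolding a_def n_def by blast
  obtain C' where C': "C' > 0" and ind: "\<And>(A::'a set) x. A \<in> lmeasurable \<Longrightarrow>
    riesz \<alpha> (indicat_real A) x \<le> ennreal (C' * measure lebesgue A powr (\<alpha> / n))"
    using riesz_indicator_le[where 'a='a, OF \<alpha>] \<alpha>n unfolding n_def by blast
  define J where "J = C + I"
  have J: "J > 0" using C I(1) by (simp add: J_def)
  \<comment> \<open>A radius this large makes the far field small for every truncation level; only
    then is \<open>\<eta>\<close> chosen to make the near field small. Each contributes
    \<open>\<epsilon> / 8\<close>.\<close>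
  define \<delta> where "\<delta> = (J * 8 / \<epsilon>) powr (1 / a)"
  have \<delta>: "\<delta> > 0" "J * \<delta> powr (- a) = \<epsilon> / 8"
  proof -
    show "\<delta> > 0" using J \<epsilon> by (simp add: \<delta>_def)
    have "\<delta> powr a = J * 8 / \<epsilon>" using J \<epsilon> a by (simp add: \<delta>_def powr_powr)
    then have "\<delta> powr (- a) = \<epsilon> / (J * 8)" by (simp add: powr_minus)
    then show "J * \<delta> powr (- a) = \<epsilon> / 8" using J by simp
  qed
  define \<eta> where "\<eta> = \<epsilon> / (8 * C * \<delta> powr \<alpha>)"
  have \<eta>: "\<eta> > 0" "C * \<eta> * \<delta> powr \<alpha> = \<epsilon> / 8" using C \<epsilon> \<delta>(1) by (auto simp: \<eta>_def)
  define A where "A = {y. \<eta> < f y}"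
  have A: "A \<in> lmeasurable"
  proof -
    have "(f y * indicat_real S y) powr \<sigma> = f y powr \<sigma> * indicat_real S y" for S y
      by (cases "y \<in> S") auto
    then show ?thesis unfolding A_def
      using \<sigma> \<eta>(1) I(1) sub[of "{y. \<eta> < f y}"] f(1)
      by (intro superlevel_Chebyshev(1)[where E = I and \<sigma> = \<sigma>]) auto
  qed
  have Am: "A \<in> sets lebesgue" using A by (rule fmeasurableD)
  define M where "M = measure lebesgue A"
  have M: "M \<ge> 0" by (simp add: M_def)
  \<comment> \<open>The measure at which \<open>riesz_indicator_le\<close>, multiplied by
    \<open>m\<close>, gives \<open>\<epsilon> / 4\<close>.\<close>
  define \<nu> where "\<nu> = (\<epsilon> / (4 * m * C')) powr (n / \<alpha>)"
  have \<nu>: "\<nu> > 0" "m * (C' * \<nu> powr (\<alpha> / n)) = \<epsilon> / 4"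
    using \<epsilon> m C' n0 \<alpha> by (auto simp: \<nu>_def powr_powr)
  have "integrable lebesgue (indicat_real A)"
    using A by (intro integrable_real_indicator) (auto simp: fmeasurable_def)
  then obtain R where R: "R > 0"
    "(\<integral>\<^sup>+y. ennreal (indicat_real A y * indicat_real {y. R < norm y} y) \<partial>lebesgue) \<le> ennreal \<nu>"
    using nn_integral_superlevel_small[of lebesgue "indicat_real A" "\<lambda>y. norm y" \<nu>] \<nu>(1)
      measurable_compose[OF ident_measurable_lebesgue borel_measurable_norm] by auto
  define B where "B = A - cball 0 R"
  define D where "D = A \<inter> cball 0 R"
  have B: "B \<in> lmeasurable" "D \<in> lmeasurable"
    using A unfolding B_def D_def by (auto intro!: fmeasurable_Diff fmeasurable_Int_fmeasurable)
  then have BDm: "B \<in> sets lebesgue" "D \<in> sets lebesgue" by (auto dest: fmeasurableD)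
  have mB: "measure lebesgue B \<le> \<nu>"
  proof -
    have "ennreal (measure lebesgue B) = (\<integral>\<^sup>+y. indicator B y \<partial>lebesgue)"
      using B BDm by (simp add: emeasure_eq_measure2)
    also have "\<dots> = (\<integral>\<^sup>+y. ennreal (indicat_real A y * indicat_real {y. R < norm y} y) \<partial>lebesgue)"
      by (intro nn_integral_cong) (auto simp: B_def indicator_def)
    also note R(2)
    finally show ?thesis using \<nu>(1) by simp
  qed
  have mD: "measure lebesgue D \<le> M"
    unfolding M_def D_def using A Am by (intro measure_mono_fmeasurable) auto
  \<comment> \<open>Solves for the distance at which the kernel bound gives
    \<open>\<epsilon> / 4\<close>; the exponent is negative because \<open>\<alpha> < n\<close>, and
    \<open>M + 1\<close> avoids division by zero when \<open>A\<close> is null.\<close>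
  define \<rho> where "\<rho> = (\<epsilon> / (4 * m * (M + 1))) powr (1 / (\<alpha> - n))"
  have \<rho>: "\<rho> > 0" "m * (\<rho> powr (\<alpha> - n) * (M + 1)) = \<epsilon> / 4"
    using \<epsilon> m M \<alpha>n by (auto simp: \<rho>_def powr_powr)
  define f1 where "f1 y = f y * indicat_real (- A) y" for y
  have f1: "f1 \<in> borel_measurable lebesgue" "\<And>y. 0 \<le> f1 y"
    using Am f unfolding f1_def by (auto intro!: borel_measurable_times borel_measurable_indicator)
  have indm: "indicat_real B \<in> borel_measurable lebesgue" "indicat_real D \<in> borel_measurable lebesgue"
    using BDm by auto
  have mindm: "(\<lambda>y. m * indicat_real B y) \<in> borel_measurable lebesgue"
    "(\<lambda>y. m * indicat_real D y) \<in> borel_measurable lebesgue"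
    using indm by (auto intro!: borel_measurable_times)
  have "w x < \<epsilon>" if x: "R + \<rho> \<le> norm x" for x
  proof -
    have "AE y in lebesgue. f y \<le> f1 y + (m * indicat_real B y + m * indicat_real D y)"
      using m(1) by eventually_elim (auto simp: f1_def B_def D_def indicator_def)
    then have "riesz \<alpha> f x \<le> riesz \<alpha> (\<lambda>y. f1 y + (m * indicat_real B y + m * indicat_real D y)) x"
      by (rule riesz_mono_AE)
    also have "\<dots> = riesz \<alpha> f1 x + (ennreal m * riesz \<alpha> (indicat_real B) x + ennreal m * riesz \<alpha> (indicat_real D) x)"
      using f1 m(2) indm mindm by (subst riesz_add, simp_all)+ (simp add: riesz_cmult)
    also have "\<dots> \<le> ennreal (\<epsilon> / 4) + (ennreal m * ennreal (C' * \<nu> powr (\<alpha> / n)) + ennreal m * ennreal (\<rho> powr (\<alpha> - n) * (M + 1)))"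
    proof (intro add_mono mult_left_mono)
      have "riesz \<alpha> f1 x \<le> ennreal (C * \<eta> * \<delta> powr \<alpha> + (C * 1 + 1 powr (1 - \<sigma>) * I) * \<delta> powr (- a))"
        using f1 \<eta>(1) \<delta>(1) I(1) sub[of "- A"]
        by (intro split) (auto simp: f1_def A_def indicator_def)
      also have "\<dots> = ennreal (\<epsilon> / 4)" 
        unfolding powr_one_eq_one mult_1_left mult_1_right \<eta>(2) \<delta>(2)[unfolded J_def] by simp
      finally show "riesz \<alpha> f1 x \<le> ennreal (\<epsilon> / 4)" .
      have "riesz \<alpha> (indicat_real B) x \<le> ennreal (C' * measure lebesgue B powr (\<alpha> / n))"
        by (rule ind[OF B(1)])
      also have "\<dots> \<le> ennreal (C' * \<nu> powr (\<alpha> / n))"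
        using mB C' \<alpha> n0 by (intro ennreal_leI mult_left_mono powr_mono2) auto
      finally show "riesz \<alpha> (indicat_real B) x \<le> ennreal (C' * \<nu> powr (\<alpha> / n))" .
      have "riesz \<alpha> (indicat_real D) x \<le> ennreal (\<rho> powr (\<alpha> - n) * measure lebesgue D)"
        unfolding n_def using B(2) \<rho>(1) x \<alpha>n by (intro riesz_indicator_far[where R = R]) (auto simp: D_def n_def)
      also have "\<dots> \<le> ennreal (\<rho> powr (\<alpha> - n) * (M + 1))"
        using mD by (intro ennreal_leI mult_left_mono) auto
      finally show "riesz \<alpha> (indicat_real D) x \<le> ennreal (\<rho> powr (\<alpha> - n) * (M + 1))" .
    qed auto
    also have "\<dots> = ennreal (\<epsilon> / 4 + (\<epsilon> / 4 + \<epsilon> / 4))"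
      using \<nu>(2) \<rho>(2) m(2) \<epsilon> by (simp add: ennreal_mult'[symmetric] ennreal_plus[symmetric] del: ennreal_plus)
    finally have "w x \<le> \<epsilon> / 4 + (\<epsilon> / 4 + \<epsilon> / 4)"
      using \<epsilon> unfolding w(2)[symmetric] by (subst (asm) ennreal_le_iff) auto
    then show ?thesis using \<epsilon> by simp
  qed
  then show "\<exists>b. \<forall>x. b \<le> norm x \<longrightarrow> dist (w x) 0 < \<epsilon>"
    using w(1) by (auto simp: dist_real_def intro!: exI[of _ "R + \<rho>"])
qed

section \<open>Vanishing of superlevel sets by a coupled iteration\<close>

text \<open>With \<open>r = n / a\<close> the weight is \<open>l powr n\<close>, so this supplies
  both the smallness that starts the iteration and the finiteness of the superlevel sets.\<close>

lemma superlevel_tail_small: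
  fixes f :: "'a::euclidean_space \<Rightarrow> real"
  assumes f: "f \<in> borel_measurable lebesgue" "\<And>y. 0 \<le> f y" and r: "0 < r" and fint: "integrable lebesgue (\<lambda>y. f y powr r)"
    and a: "0 < a" and \<epsilon>: "0 < \<epsilon>"
  shows "\<exists>L>0. \<forall>l\<ge>L. {y. l powr a < f y} \<in> lmeasurable \<and>
    l powr (a * r) * measure lebesgue {y. l powr a < f y} \<le> \<epsilon>"
proof -
  obtain m where m: "m > 0" "(\<integral>\<^sup>+y. ennreal (f y powr r * indicat_real {y. m < f y} y) \<partial>lebesgue) \<le> ennreal \<epsilon>"
    using nn_integral_superlevel_small[OF fint _ f(1) \<epsilon>] by auto
  define L where "L = m powr (1 / a)"
  have L: "L > 0" "L powr a = m" using m a by (auto simp: L_def powr_powr)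
  have "{y. l powr a < f y} \<in> lmeasurable \<and> l powr (a * r) * measure lebesgue {y. l powr a < f y} \<le> \<epsilon>"
    if l: "L \<le> l" for l
  proof -
    have ml: "m \<le> l powr a" using l L a by (auto simp flip: L(2) intro!: powr_mono2)
    have E: "(\<integral>\<^sup>+y. ennreal (f y powr r * indicat_real {y. l powr a < f y} y) \<partial>lebesgue) \<le> ennreal \<epsilon>"
      using m(2) ml by (elim order.trans[rotated]) (auto intro!: nn_integral_mono simp: indicator_def)
    have la: "0 < l powr a" using m ml by linarith
    show ?thesis
      using superlevel_Chebyshev[OF f(1) la r E less_imp_le[OF \<epsilon>]] unfolding powr_powr by blast
  qed
  with L show ?thesis by blast
qed

text \<open>Below a fixed size the superlinear map \<open>N \<mapsto> (C * N) powr \<tau>\<close> at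
  least halves its argument. A bound on a half-line is therefore halved on the same half-line, any
  number of times.\<close>

lemma alternating_superlinear_vanish:
  fixes X Y :: "real \<Rightarrow> real"
  assumes nonneg: "\<And>l. 0 \<le> X l" "\<And>l. 0 \<le> Y l" and \<tau>: "1 < \<tau>" and C: "0 < C"
    and stepX: "\<And>l N. l\<^sub>1 \<le> l \<Longrightarrow> 0 \<le> N \<Longrightarrow> (\<And>s. l \<le> s \<Longrightarrow> Y s \<le> N) \<Longrightarrow> X l \<le> (C * N) powr \<tau>"
    and stepY: "\<And>l N. l\<^sub>1 \<le> l \<Longrightarrow> 0 \<le> N \<Longrightarrow> (\<And>s. l \<le> s \<Longrightarrow> X s \<le> N) \<Longrightarrow> Y l \<le> (C * N) powr \<tau>"
    and small: "\<And>\<epsilon>. 0 < \<epsilon> \<Longrightarrow> \<exists>L>0. \<forall>l\<ge>L. X l \<le> \<epsilon>" "\<And>\<epsilon>. 0 < \<epsilon> \<Longrightarrow> \<exists>L>0. \<forall>l\<ge>L. Y l \<le> \<epsilon>"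
  shows "\<exists>L>0. \<forall>l\<ge>L. X l = 0 \<and> Y l = 0"
proof -
  \<comment> \<open>The solution of \<open>C powr \<tau> * N0 powr (\<tau> - 1) = 1 / 2\<close>,
    hence the largest size at which halving is guaranteed.\<close>
  define N0 where "N0 = (1 / (2 * C powr \<tau>)) powr (1 / (\<tau> - 1))"
  have N0: "N0 > 0" "C powr \<tau> * N0 powr (\<tau> - 1) = 1 / 2"
    using C \<tau> by (auto simp: N0_def powr_powr)
  have contr: "(C * N) powr \<tau> \<le> N / 2" if N: "0 < N" "N \<le> N0" for N
  proof -
    have "(C * N) powr \<tau> = C powr \<tau> * N powr (\<tau> - 1) * N"
      using N C by (simp add: powr_mult powr_diff)
    also have "\<dots> \<le> C powr \<tau> * N0 powr (\<tau> - 1) * N"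
      using N \<tau> by (intro mult_right_mono mult_left_mono powr_mono2) auto
    finally show ?thesis using N0 by simp
  qed
  obtain LX LY where L: "\<forall>l\<ge>LX. X l \<le> N0" "\<forall>l\<ge>LY. Y l \<le> N0"
    using small(1)[OF N0(1)] small(2)[OF N0(1)] by blast
  \<comment> \<open>One threshold for all rounds: the step at \<open>l\<close> uses only values at
    \<open>s \<ge> l\<close>, so it need not move with \<open>j\<close>.\<close>
  define L where "L = max 1 (max l\<^sub>1 (max LX LY))"
  have ind: "\<forall>l\<ge>L. X l \<le> N0 / 2 ^ j \<and> Y l \<le> N0 / 2 ^ j" for j
  proof (induction j)
    case 0
    then show ?case using L by (auto simp: L_def)
  next
    case (Suc j)
    define N where "N = N0 / 2 ^ j"
    have N: "0 < N" "N \<le> N0" using N0(1) by (auto simp: N_def divide_le_eq)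
    have "X l \<le> N / 2 \<and> Y l \<le> N / 2" if l: "L \<le> l" for l
    proof
      show "X l \<le> N / 2"
        using stepX[of l N] contr[OF N] Suc N l by (force simp: N_def L_def)
      show "Y l \<le> N / 2"
        using stepY[of l N] contr[OF N] Suc N l by (force simp: N_def L_def)
    qed
    then show ?case by (simp add: N_def mult.commute)
  qed
  have lim: "(\<lambda>j. N0 / 2 ^ j) \<longlonglongrightarrow> 0"
    by (rule LIMSEQ_divide_realpow_zero) simp
  have "X l = 0 \<and> Y l = 0" if "L \<le> l" for l
  proof
    have "X l \<le> 0" using ind that by (intro LIMSEQ_le_const[OF lim]) auto
    then show "X l = 0" using nonneg(1)[of l] by simp
    have "Y l \<le> 0" using ind that by (intro LIMSEQ_le_const[OF lim]) auto
    then show "Y l = 0" using nonneg(2)[of l] by simp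
  qed
  then show ?thesis by (intro exI[of _ L]) (auto simp: L_def)
qed

text \<open>What a single equation of the system yields, in a form that is applied twice with the
  roles of \<open>u\<close> and \<open>v\<close> exchanged.\<close>

lemma riesz_power_half:
  fixes u v :: "'a::euclidean_space \<Rightarrow> real"
  defines "n \<equiv> real DIM('a)"
  assumes \<alpha>: "0 < \<alpha>" and ab: "0 < a" "0 < b" "0 < q" "q * b = a + \<alpha>" "a + \<alpha> < n"
    and u: "u \<in> borel_measurable lebesgue" "\<And>x. 0 < u x" "integrable lebesgue (\<lambda>x. u x powr (n / a))"
    and v: "v \<in> borel_measurable lebesgue" "\<And>x. 0 < v x" "integrable lebesgue (\<lambda>x. v x powr (n / b))"
    and eq: "\<And>x. ennreal (u x) = riesz \<alpha> (\<lambda>y. v y powr q) x"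
  shows "\<exists>C>0. \<exists>l\<^sub>1. \<forall>l\<ge>l\<^sub>1. \<forall>N\<ge>0. (\<forall>s\<ge>l. s powr n * measure lebesgue {y. s powr b < v y} \<le> N) \<longrightarrow>
      l powr n * measure lebesgue {y. l powr a < u y} \<le> (C * N) powr (n / (n - \<alpha>))"
    and "0 < M \<Longrightarrow> AE y in lebesgue. v y \<le> M \<Longrightarrow> bounded (range u) \<and> (u \<longlongrightarrow> 0) at_infinity"
proof -
  define f where "f y = v y powr q" for y
  define \<sigma> where "\<sigma> = n / (a + \<alpha>)"
  have n0: "n > 0" by (simp add: n_def)
  have \<sigma>: "1 < \<sigma>" "\<alpha> * \<sigma> < n" "n / \<sigma> - \<alpha> = a"
    using ab \<alpha> n0 by (auto simp: \<sigma>_def field_simps)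
  have f: "f \<in> borel_measurable lebesgue" "\<And>y. 0 \<le> f y"
    unfolding f_def using v(1) by (auto intro!: powr_real_measurable)
  have "q * \<sigma> = n / b" using ab by (simp add: \<sigma>_def flip: ab(4))
  then have fint: "integrable lebesgue (\<lambda>y. f y powr \<sigma>)"
    using v(3) by (simp add: f_def powr_powr)
  have eqf: "ennreal (u x) = riesz \<alpha> f x" for x unfolding f_def by (rule eq)
  \<comment> \<open>Because \<open>q * b = a + \<alpha>\<close>, the levels natural for the source
    \<open>v powr q\<close> are exactly those natural for \<open>v\<close>.\<close>
  have lev: "s powr (a + \<alpha>) < f y \<longleftrightarrow> s powr b < v y" if "s > 0" for s y
  proof -
    have "s powr (a + \<alpha>) = (s powr b) powr q" by (simp add: powr_powr mult.commute flip: ab(4))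
    then show ?thesis unfolding f_def
      using ab(3) less_imp_le[OF v(2)[of y]] powr_less_mono2[of q "s powr b" "v y"]
        powr_mono2[of q "v y" "s powr b"] by (metis less_imp_le not_le powr_ge_zero)
  qed
  show "\<exists>C>0. \<exists>l\<^sub>1. \<forall>l\<ge>l\<^sub>1. \<forall>N\<ge>0. (\<forall>s\<ge>l. s powr n * measure lebesgue {y. s powr b < v y} \<le> N) \<longrightarrow>
      l powr n * measure lebesgue {y. l powr a < u y} \<le> (C * N) powr (n / (n - \<alpha>))"
  proof -
    obtain C l1 where C: "C > 0" "l1 > 0" and step: "\<And>l A N. l1 \<le> l \<Longrightarrow> A \<in> lmeasurable \<Longrightarrow> 0 \<le> N \<Longrightarrow>
      (\<And>x. x \<in> A \<Longrightarrow> ennreal (l powr a) \<le> riesz \<alpha> f x) \<Longrightarrow>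
      (\<And>s. l \<le> s \<Longrightarrow> s powr n * measure lebesgue {y. s powr (a + \<alpha>) < f y} \<le> N) \<Longrightarrow>
      l powr n * measure lebesgue A \<le> (C * N) powr (n / (n - \<alpha>))"
      using riesz_superlevel_step[OF \<alpha> \<sigma>(1) \<sigma>(2)[unfolded n_def] f fint] \<sigma>(3) unfolding n_def by metis
    obtain L where L: "\<And>l. l \<ge> L \<Longrightarrow> {y. l powr a < u y} \<in> lmeasurable"
      using superlevel_tail_small[OF u(1) less_imp_le[OF u(2)] divide_pos_pos[OF n0 ab(1)] u(3) ab(1) zero_less_one]
      by blast
    have "l powr n * measure lebesgue {y. l powr a < u y} \<le> (C * N) powr (n / (n - \<alpha>))"
      if l: "max l1 L \<le> l" and N: "0 \<le> N"
        and tail: "\<forall>s\<ge>l. s powr n * measure lebesgue {y. s powr b < v y} \<le> N" for l N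
    proof (rule step)
      show "ennreal (l powr a) \<le> riesz \<alpha> f x" if "x \<in> {y. l powr a < u y}" for x
        using that unfolding eqf[symmetric] by (intro ennreal_leI) simp
      show "s powr n * measure lebesgue {y. s powr (a + \<alpha>) < f y} \<le> N" if "l \<le> s" for s
      proof -
        have "0 < s" using that l C(2) by simp
        from lev[OF this] show ?thesis using tail that by presburger
      qed
    qed (use l N L in auto)
    with C show ?thesis by blast
  qed
  show "bounded (range u) \<and> (u \<longlongrightarrow> 0) at_infinity" if M: "0 < M" "AE y in lebesgue. v y \<le> M"
  proof
    have fM: "AE y in lebesgue. f y \<le> M powr q"
      using M(2) by eventually_elim (use ab v(2) in \<open>auto simp: f_def less_imp_le intro!: powr_mono2\<close>)
    obtain K where "K \<ge> 0" "\<And>x. riesz \<alpha> f x \<le> ennreal K"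
      using riesz_bounded[OF \<alpha> \<sigma>(1) \<sigma>(2)[unfolded n_def] f fint fM] by auto
    then have "norm (u x) \<le> K" for x
      using u(2)[of x] unfolding eqf[symmetric] by (simp add: less_imp_le)
    then show "bounded (range u)" by (auto simp: bounded_iff)
    show "(u \<longlongrightarrow> 0) at_infinity"
      using riesz_tendsto_0[OF \<alpha> \<sigma>(1) \<sigma>(2)[unfolded n_def] f fint fM _ _ eqf] u(2) M(1) by (simp add: less_imp_le)
  qed
qed

text \<open>The two kernels agree also on the diagonal, where division by zero and
  \<open>0 powr e = 0\<close> both give 0. Integrability makes the Bochner integral equal to the
  nonnegative one.\<close>

lemma riesz_identity_imp_riesz:
  fixes w f :: "real^'n \<Rightarrow> real"
  assumes "riesz_identity \<alpha> w e f"
  shows "ennreal (w x) = riesz \<alpha> (\<lambda>y. f y powr e) x"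
proof -
  have *: "f y powr e / norm (x - y) powr (real CARD('n) - \<alpha>)
      = f y powr e * norm (x - y) powr (\<alpha> - real CARD('n))" for y
    using powr_minus_divide[of "norm (x - y)" "real CARD('n) - \<alpha>"] by simp
  have int: "integrable lebesgue (\<lambda>y. f y powr e * norm (x - y) powr (\<alpha> - real CARD('n)))"
    and w: "w x = (\<integral>y. f y powr e * norm (x - y) powr (\<alpha> - real CARD('n)) \<partial>lebesgue)"
    using assms[unfolded riesz_identity_def, rule_format, of x] unfolding * by auto
  show ?thesis unfolding riesz_def w DIM_cart
    by (subst nn_integral_eq_integral[symmetric]) (use int in auto)
qed

theorem theorem3p1:
  fixes u v :: "real^'n \<Rightarrow> real" and \<alpha> p q :: real
  assumes "CARD('n) \<ge> 3"
    and "0 < \<alpha>" "\<alpha> < real CARD('n)"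
    and "p > 0" "q > 0" "p * q > 1"
    and "1 / (p + 1) + 1 / (q + 1) \<le> (real CARD('n) - \<alpha>) / real CARD('n)"
    and "in_Lp (real CARD('n) * (p * q - 1) / (\<alpha> * (q + 1))) u"
    and "in_Lp (real CARD('n) * (p * q - 1) / (\<alpha> * (p + 1))) v"
    and "positive_solution \<alpha> p q u v"
  shows "bounded (range u) \<and> bounded (range v) \<and>
         (u \<longlongrightarrow> 0) at_infinity \<and> (v \<longlongrightarrow> 0) at_infinity"
proof -
  define n where "n = real CARD('n)"
  have dim: "real DIM(real^'n) = n" by (simp add: n_def)
  have n0: "n > 0" by (simp add: n_def)
  define a where "a = \<alpha> * (q + 1) / (p * q - 1)"
  define b where "b = \<alpha> * (p + 1) / (p * q - 1)"
  note pq = assms(2-6)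
  have ab: "a > 0" "b > 0" using pq by (auto simp: a_def b_def)
  have qb: "q * b = a + \<alpha>" and pa: "p * a = b + \<alpha>"
    using pq by (simp_all add: a_def b_def divide_simps) (simp_all add: algebra_simps)
  have abn: "a + b \<le> n - \<alpha>"
  proof -
    \<comment> \<open>Rewritten this way, the assumption bounds
      \<open>(p * q - 1) / ((p + 1) * (q + 1))\<close> from below by \<open>\<alpha> / n\<close>;
      its reciprocal times \<open>\<alpha>\<close> is \<open>\<alpha> + (a + b)\<close>.\<close>
    have "1 / (p + 1) + 1 / (q + 1) = (p + q + 2) / ((p + 1) * (q + 1))"
      using pq by (simp add: divide_simps)
    also have "\<dots> = 1 - (p * q - 1) / ((p + 1) * (q + 1))"
      using pq by (simp add: divide_simps) (simp add: algebra_simps)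
    finally have "\<alpha> / n \<le> (p * q - 1) / ((p + 1) * (q + 1))"
      using assms(7) n0 by (simp add: n_def[symmetric] diff_divide_distrib)
    then have "\<alpha> * ((p + 1) * (q + 1)) \<le> (p * q - 1) * n"
      using pq n0 by (simp add: divide_le_eq le_divide_eq mult_pos_pos mult_ac)
    then have "\<alpha> * ((p + 1) * (q + 1)) / (p * q - 1) \<le> n" using pq by (simp add: divide_le_eq mult.commute)
    moreover have "\<alpha> * ((p + 1) * (q + 1)) / (p * q - 1) = \<alpha> + (a + b)"
      using pq by (simp add: a_def b_def divide_simps) (simp add: algebra_simps)
    ultimately show ?thesis by simp
  qed
  have u: "u \<in> borel_measurable lebesgue" "\<And>x. 0 < u x" and v: "v \<in> borel_measurable lebesgue" "\<And>x. 0 < v x"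
    and ru: "riesz_identity \<alpha> u q v" and rv: "riesz_identity \<alpha> v p u"
    using assms(10) by (auto simp: positive_solution_def)
  have exps: "n * (p * q - 1) / (\<alpha> * (q + 1)) = n / a" "n * (p * q - 1) / (\<alpha> * (p + 1)) = n / b"
    by (simp_all add: a_def b_def)
  have ui: "integrable lebesgue (\<lambda>x. u x powr (n / a))" and vi: "integrable lebesgue (\<lambda>x. v x powr (n / b))"
    using assms(8,9) u(2) v(2) unfolding in_Lp_def n_def[symmetric] exps by (simp_all add: less_imp_le)
  note equ = riesz_identity_imp_riesz[OF ru] and eqv = riesz_identity_imp_riesz[OF rv]
  \<comment> \<open>Positivity of the other exponent makes these strict, so both sources lie in
    spaces with exponent greater than 1.\<close>
  have bn: "a + \<alpha> < n" "b + \<alpha> < n" using ab abn by auto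
  note halfu = riesz_power_half[where u = u and v = v, unfolded dim,
      OF pq(1) ab pq(4) qb bn(1) u ui v vi equ]
  note halfv = riesz_power_half[where u = v and v = u, unfolded dim,
      OF pq(1) ab(2,1) pq(3) pa bn(2) v vi u ui eqv]
  define \<tau> where "\<tau> = n / (n - \<alpha>)"
  have \<tau>: "1 < \<tau>" using pq by (simp add: \<tau>_def n_def)
  define X where "X l = l powr n * measure lebesgue {y. l powr a < u y}" for l
  define Y where "Y l = l powr n * measure lebesgue {y. l powr b < v y}" for l
  obtain C1 l1 where 1: "C1 > 0" "\<And>l N. l1 \<le> l \<Longrightarrow> 0 \<le> N \<Longrightarrow> (\<And>s. l \<le> s \<Longrightarrow> Y s \<le> N) \<Longrightarrow> X l \<le> (C1 * N) powr \<tau>"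
    using halfu(1) unfolding X_def Y_def \<tau>_def by blast
  obtain C2 l2 where 2: "C2 > 0" "\<And>l N. l2 \<le> l \<Longrightarrow> 0 \<le> N \<Longrightarrow> (\<And>s. l \<le> s \<Longrightarrow> X s \<le> N) \<Longrightarrow> Y l \<le> (C2 * N) powr \<tau>"
    using halfv(1) unfolding X_def Y_def \<tau>_def by blast
  define C where "C = max C1 C2"
  have Cmono: "(C1 * N) powr \<tau> \<le> (C * N) powr \<tau>" "(C2 * N) powr \<tau> \<le> (C * N) powr \<tau>" if "0 \<le> N" for N
    using that 1(1) 2(1) \<tau> by (auto simp: C_def intro!: powr_mono2 mult_right_mono)
  have tails: "\<exists>L>0. \<forall>l\<ge>L. {y. l powr a < u y} \<in> lmeasurable \<and> X l \<le> \<epsilon>"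
    "\<exists>L>0. \<forall>l\<ge>L. {y. l powr b < v y} \<in> lmeasurable \<and> Y l \<le> \<epsilon>" if "0 < \<epsilon>" for \<epsilon>
  proof -
    have "0 < n / a" "0 < n / b" "a * (n / a) = n" "b * (n / b) = n" using n0 ab by auto
    then show "\<exists>L>0. \<forall>l\<ge>L. {y. l powr a < u y} \<in> lmeasurable \<and> X l \<le> \<epsilon>"
      "\<exists>L>0. \<forall>l\<ge>L. {y. l powr b < v y} \<in> lmeasurable \<and> Y l \<le> \<epsilon>"
      using superlevel_tail_small[OF u(1) less_imp_le[OF u(2)] _ ui ab(1) that]
        superlevel_tail_small[OF v(1) less_imp_le[OF v(2)] _ vi ab(2) that]
      unfolding X_def Y_def by (metis, metis)
  qed
  have "\<exists>L>0. \<forall>l\<ge>L. X l = 0 \<and> Y l = 0"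
  proof (rule alternating_superlinear_vanish[where \<tau> = \<tau> and C = C and l\<^sub>1 = "max l1 l2"])
    show "X l \<le> (C * N) powr \<tau>" if "max l1 l2 \<le> l" "0 \<le> N" "\<And>s. l \<le> s \<Longrightarrow> Y s \<le> N" for l N
      using 1(2)[of l N] that Cmono(1)[of N] by force
    show "Y l \<le> (C * N) powr \<tau>" if "max l1 l2 \<le> l" "0 \<le> N" "\<And>s. l \<le> s \<Longrightarrow> X s \<le> N" for l N
      using 2(2)[of l N] that Cmono(2)[of N] by force
    show "\<exists>L>0. \<forall>l\<ge>L. X l \<le> \<epsilon>" if "0 < \<epsilon>" for \<epsilon> using tails(1)[OF that] by blast
    show "\<exists>L>0. \<forall>l\<ge>L. Y l \<le> \<epsilon>" if "0 < \<epsilon>" for \<epsilon> using tails(2)[OF that] by blast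
    show "0 \<le> X l" "0 \<le> Y l" for l
      unfolding X_def Y_def by (intro mult_nonneg_nonneg measure_nonneg powr_ge_zero)+
    show "0 < C" using 1(1) by (simp add: C_def less_max_iff_disj)
  qed (rule \<tau>)
  then obtain L where L: "L > 0" "\<And>l. L \<le> l \<Longrightarrow> X l = 0" "\<And>l. L \<le> l \<Longrightarrow> Y l = 0" by blast
  obtain L1 where L1: "\<And>l. L1 \<le> l \<Longrightarrow> {y. l powr a < u y} \<in> lmeasurable" using tails(1)[OF zero_less_one] by blast
  obtain L2 where L2: "\<And>l. L2 \<le> l \<Longrightarrow> {y. l powr b < v y} \<in> lmeasurable" using tails(2)[OF zero_less_one] by blast
  define l where "l = max L (max L1 L2)"
  have l: "l > 0" "L \<le> l" "L1 \<le> l" "L2 \<le> l" using L(1) by (auto simp: l_def)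
  \<comment> \<open>Since \<open>measure\<close> is also 0 on sets of infinite measure, finiteness
    of the superlevel set has to accompany the vanishing.\<close>
  have bound_AE: "AE y in lebesgue. w y \<le> c"
    if "{y. c < w y} \<in> lmeasurable" "measure lebesgue {y. c < w y} = 0" for w :: "real^'n \<Rightarrow> real" and c
  proof -
    have "{y. c < w y} \<in> null_sets lebesgue"
      using that by (simp add: null_sets_def fmeasurableD emeasure_eq_measure2)
    from AE_not_in[OF this] show ?thesis by eventually_elim auto
  qed
  have ln: "l powr n \<noteq> 0" using l(1) by simp
  have "measure lebesgue {y. l powr a < u y} = 0"
    using iffD1[OF mult_eq_0_iff L(2)[OF l(2), unfolded X_def]] ln by blast
  then have "AE y in lebesgue. u y \<le> l powr a" by (rule bound_AE[OF L1[OF l(3)]])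
  moreover have "measure lebesgue {y. l powr b < v y} = 0"
    using iffD1[OF mult_eq_0_iff L(3)[OF l(2), unfolded Y_def]] ln by blast
  then have "AE y in lebesgue. v y \<le> l powr b" by (rule bound_AE[OF L2[OF l(4)]])
  \<comment> \<open>The bounds are used crosswise: the essential bound on \<open>v\<close> settles
    \<open>u\<close>, and the one on \<open>u\<close> settles \<open>v\<close>.\<close>
  ultimately show ?thesis
    using halfu(2)[of "l powr b"] halfv(2)[of "l powr a"] l(1) by simp
qed

end
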